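(* For any $k,p\in\mathbb{N}_0$, $\mathbf m=(m_1,\ldots,m_p)\in\mathbb{N}^p$ and $x\in[0,1]$, we have $$\sum_{n=1}^\infty\frac{\zeta_n^\star(\mathbf m^\vee;x)}{n^{k+2}4^n}\binom{2n}{n}=\sum_{j=1}^p(-1)^{p-j}\operatorname{Li}_{m_p,\ldots,m_{j+1}}(1-x)\sum_{n=1}^\infty\frac{\zeta_n^\star\bigl((m_1,\ldots,m_j)^\vee\bigr)}{n^{k+2}4^n}\binom{2n}{n}$$ $$+(-1)^{p+k}\,2\log(2)\,\operatorname{Li}_{\mathbf m^{*},1_k}(1-x)+\sum_{j=1}^k(-1)^{p+k-j}\operatorname{Li}_{\mathbf m^{*},1_{k-j}}(1-x)\sum_{n=1}^\infty\frac{\binom{2n}{n}}{n^{j+1}4^n}$$ $$+(-1)^{p+k}2^{|\mathbf m|+2-p}\sum_{\sigma_1,\ldots,\sigma_{p+k}\in\{\pm1\}}\operatorname{Li}_{\mathbf m^{*},1_{k+1}}\bigl(\sigma_1\sqrt{1-x},\sigma_1\sigma_2,\ldots,\sigma_{p+k-1}\sigma_{p+k},-\sigma_{p+k}\bigr),$$ where $|\mathbf m|=m_1+\cdots+m_p$ and $\mathbf m^{*}:=(m_p,m_{p-1},\ldots,m_2,m_1+1)$, i.e. the reversal of $\mathbf m$ with its last entry increased by $1$.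
   Context: $\mathbb{N}$ is the set of positive integers and $\mathbb{N}_0=\mathbb{N}\cup\{0\}$; $1_d$ denotes the sequence of $d$ ones (empty for $d=0$), and $\mathbf m^{*},1_d$ denotes concatenation. Multiple harmonic star sums: $\zeta_n^\star(k_1,\ldots,k_r)=\sum_{n\ge n_1\ge\cdots\ge n_r\ge1}\frac{1}{n_1^{k_1}\cdots n_r^{k_r}}$, $\zeta_n^\star(\emptyset)=1$; parametric version: $\zeta_n^\star(k_1,\ldots,k_r;x)=\sum_{n\ge n_1\ge\cdots\ge n_r\ge1}\frac{x^{n_r}}{n_1^{k_1}\cdots n_r^{k_r}}$, $\zeta_n^\star(\emptyset;x)=x^n$. Multiple polylogarithms: $\operatorname{Li}_{k_1,\ldots,k_r}(x_1,\ldots,x_r)=\sum_{n_1>\cdots>n_r>0}\frac{x_1^{n_1}\cdots x_r^{n_r}}{n_1^{k_1}\cdots n_r^{k_r}}$; the one-variable version is $\operatorname{Li}_{k_1,\ldots,k_r}(z)=\sum_{n_1>\cdots>n_r>0}\frac{z^{n_1}}{n_1^{k_1}\cdots n_r^{k_r}}$, and $\operatorname{Li}_\emptyset=1$ (this is the factor for $j=p$ in the first sum on the right). Hoffman dual: for a composition $\mathbf m=(m_1,\ldots,m_p)$, the dual $\mathbf m^\vee=(m_1',\ldots,m'_{p'})$ is the unique composition of the same weight $|\mathbf m|$ such that $\{1,2,\ldots,|\mathbf m|-1\}$ is the disjoint union of $\{\sum_{i=1}^j m_i\}_{j=1}^{p-1}$ and $\{\sum_{i=1}^j m'_i\}_{j=1}^{p'-1}$.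 E.g. $(1,1,2,1)^\vee=(3,2)$.
   Formalization: The case p=0 is excluded, since m* refers to m_1 and is undefined there; at x=0 with p≥2 and m_p=1, where Li_{m_p,...,m_{j+1}}(1) diverges, the equality is replaced by the statement that the right-hand side tends to the left-hand side's value at 0 as x→0+. *)

theory Defs
  imports "HOL-Analysis.Analysis"
begin

definition is_composition :: "nat list \<Rightarrow> bool" where
  "is_composition ks \<longleftrightarrow> (\<forall>k\<in>set ks. 1 \<le> k)"

definition proper_partial_sums :: "nat list \<Rightarrow> nat set" where
  "proper_partial_sums ks = (\<lambda>j. sum_list (take j ks)) ` {1..<length ks}"

definition hoffman_dual :: "nat list \<Rightarrow> nat list" where
  "hoffman_dual m = (THE m'. is_composition m' \<and> sum_list m' = sum_list m \<and>
     proper_partial_sums m \<inter> proper_partial_sums m' = {} \<and>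
     proper_partial_sums m \<union> proper_partial_sums m' = {1..<sum_list m})"

definition star_indices :: "nat \<Rightarrow> nat \<Rightarrow> nat list set" where
  "star_indices n r = {ns. length ns = r \<and> sorted_wrt (\<ge>) ns \<and> set ns \<subseteq> {1..n}}"

definition zeta_star :: "nat \<Rightarrow> nat list \<Rightarrow> real" where
  "zeta_star n ks =
     (\<Sum>ns\<in>star_indices n (length ks). 1 / (\<Prod>i<length ks. real (ns ! i) ^ (ks ! i)))"

definition zeta_star_param :: "nat \<Rightarrow> nat list \<Rightarrow> real \<Rightarrow> real" where
  "zeta_star_param n ks x =
     (if ks = [] then x ^ n
      else (\<Sum>ns\<in>star_indices n (length ks).
              x ^ last ns / (\<Prod>i<length ks. real (ns ! i) ^ (ks ! i))))"

definition polylog_indices :: "nat \<Rightarrow> nat list set" where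
  "polylog_indices r = {ns. length ns = r \<and> sorted_wrt (>) ns \<and> (\<forall>n\<in>set ns. 0 < n)}"

definition multi_polylog :: "nat list \<Rightarrow> real list \<Rightarrow> real" where
  "multi_polylog ks xs =
     (\<Sum>\<^sub>\<infinity>ns\<in>polylog_indices (length ks).
        \<Prod>i<length ks. (xs ! i) ^ (ns ! i) / real (ns ! i) ^ (ks ! i))"

definition multi_polylog1 :: "nat list \<Rightarrow> real \<Rightarrow> real" where
  "multi_polylog1 ks z =
     (if ks = [] then 1
      else (\<Sum>\<^sub>\<infinity>ns\<in>polylog_indices (length ks).
              z ^ hd ns / (\<Prod>i<length ks. real (ns ! i) ^ (ks ! i))))"

text \<open>
  The reversal of a nonempty \<open>m\<close> with its last entry increased by one. It is only meaningful for
  \<open>m \<noteq> []\<close>, since it refers to the first entry of \<open>m\<close>.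
\<close>

definition reverse_incr :: "nat list \<Rightarrow> nat list" where
  "reverse_incr m = rev (tl m) @ [hd m + 1]"

end

theory Submission
  imports Defs
begin

text \<open>
Write \<open>a\<^sub>n = binom (2n) n / 4\<^sup>n\<close>, \<open>K = reverse_incr m @ 1\<^sub>k\<close> and \<open>s = sqrt (1 - x)\<close>. Both sides of the
identity are power series, the left one in \<open>x\<close> and the right one in \<open>s\<close>, and they satisfy the same
recursive system of differential equations, indexed by the composition \<open>K\<close> and obtained by
decreasing its first part.

On the left, interchanging the summation over \<open>n\<close> with the sums inside \<open>\<zeta>\<^sup>\<star>\<close> gives a series
\<open>L\<^sub>K(x) = \<Sum>\<^sub>l e\<^sub>K(l) x\<^sup>l\<close>. The two elementary changes of \<open>m\<close> (append a part \<open>1\<close>, or increase the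
last part) turn, under Hoffman duality, into increasing the last part of the dual, respectively
appending a part \<open>1\<close> to it; on coefficients these are division by \<open>l\<close>, respectively taking tail
sums and dividing by \<open>l\<close> (\<open>fold_star_step_dual\<close>, \<open>has_sum_zeta_star_dual\<close>). In analytic terms
  \<open>x L'\<^bsub>1,K\<^esub> = L\<^sub>K\<close>  and  \<open>(1 - x) L'\<^bsub>a+1,K\<^esub> = L\<^bsub>a,K\<^esub>(1) - L\<^bsub>a,K\<^esub>\<close>.
With \<open>t = 1 - x\<close> these are, up to signs and constants, the differential equations
\<open>(1 - t) Li'\<^bsub>1,K\<^esub> = Li\<^sub>K\<close> and \<open>t Li'\<^bsub>a+1,K\<^esub> = Li\<^bsub>a,K\<^esub>\<close> of the polylogarithms. The recursion ends at
the empty composition, where \<open>\<Sum>\<^sub>n a\<^sub>n x\<^sup>n / n = 2 log 2 - 2 log (1 + s)\<close>: this is where the square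
root, and with it the constant \<open>2 log 2\<close>, comes from.

In the variable \<open>s\<close>, solving the equation for a part \<open>a\<close> is the operator \<open>li_step a\<close> on power series
coefficients: \<open>(2/N)\<^sup>a\<close> times the sum of the earlier coefficients at indices of the parity of \<open>N\<close>.
Hence \<open>L\<^sub>K(1 - s\<^sup>2)\<close> is the series whose coefficients \<open>r\<^sub>K\<close> satisfy
\<open>r\<^bsub>a,K\<^esub> = L\<^bsub>a,K\<^esub>(1) \<delta>\<^sub>0 - li_step a r\<^sub>K\<close> (\<open>powser_central_coeff\<close>). Unwinding this linear recursion gives
an alternating sum over the ways to cut \<open>K\<close> in two, the first piece acting on \<open>\<delta>\<^sub>0\<close>, together with one
term in which all of \<open>K\<close> acts on the coefficients of \<open>-2 log (1 + s)\<close> (\<open>sqrt_coeff_expand\<close>). Acting on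
\<open>\<delta>\<^sub>0\<close> produces the one-variable polylogarithm at \<open>s\<^sup>2 = 1 - x\<close> (\<open>multi_polylog1_eq_powser\<close>). The
last term is a nested sum in which all indices have equal parity; that condition is detected by
averaging over signs, which produces the sum over \<open>\<sigma>\<close> (\<open>sum_signs_multi_polylog\<close>).

At \<open>x = 0\<close>, that is \<open>s = 1\<close>, the series in \<open>s\<close> still converges absolutely when the first part of \<open>K\<close>
is at least \<open>2\<close>, and the identity extends by continuity. Otherwise only the continuity of the left-hand
side is used, which turns the identity for \<open>x > 0\<close> into a statement about the limit.
\<close>

section \<open>Hoffman duality\<close>

lemma proper_partial_sums_Nil [simp]: "proper_partial_sums [] = {}"
  by (simp add: proper_partial_sums_def)

lemma proper_partial_sums_snoc:
  "proper_partial_sums (ks @ [a]) = (if ks = [] then {} else insert (sum_list ks) (proper_partial_sums ks))"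
proof (cases "ks = []")
  case False
  then have "{1..<length (ks @ [a])} = insert (length ks) {1..<length ks}"
    by (auto simp: Suc_le_eq)
  moreover have "(\<lambda>j. sum_list (take j (ks @ [a]))) ` {1..<length ks} = proper_partial_sums ks"
    unfolding proper_partial_sums_def by (rule image_cong) auto
  ultimately show ?thesis using False
    unfolding proper_partial_sums_def by simp
qed (simp add: proper_partial_sums_def)

lemma is_composition_snoc [simp]:
  "is_composition (ks @ [a]) \<longleftrightarrow> is_composition ks \<and> 1 \<le> a"
  by (auto simp: is_composition_def)

lemma is_composition_Nil [simp]: "is_composition []"
  by (simp add: is_composition_def)

lemma sum_list_pos_composition:
  assumes "is_composition ks" "ks \<noteq> []"
  shows "0 < sum_list ks"
  using assms by (cases ks) (auto simp: is_composition_def)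

lemma proper_partial_sums_less:
  "is_composition ks \<Longrightarrow> i \<in> proper_partial_sums ks \<Longrightarrow> 0 < i \<and> i < sum_list ks"
proof (induction ks arbitrary: i rule: rev_induct)
  case (snoc a ks)
  have i: "ks \<noteq> []" "i = sum_list ks \<or> i \<in> proper_partial_sums ks" "1 \<le> a" "is_composition ks"
    using snoc.prems by (auto simp: proper_partial_sums_snoc split: if_splits)
  then have "0 < sum_list ks" by (simp add: sum_list_pos_composition)
  with i snoc.IH[of i] have "0 < i \<and> i \<le> sum_list ks" by auto
  with i show ?case by simp
qed simp

text \<open>
The last part is the total minus the largest proper partial sum (minus zero if there is none);
removing it also removes that partial sum, so induction on the number of parts applies. This makes
the description of the Hoffman dual by its partial sums unambiguous.
\<close>

lemma composition_eqI:
  assumes "is_composition ks" "is_composition ls" "sum_list ks = sum_list ls"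
    "proper_partial_sums ks = proper_partial_sums ls"
  shows "ks = ls"
  using assms
proof (induction ks arbitrary: ls rule: rev_induct)
  case Nil
  then show ?case using sum_list_pos_composition[of ls] by (metis less_irrefl sum_list.Nil)
next
  case (snoc a ks)
  have "ls \<noteq> []" using sum_list_pos_composition[OF snoc.prems(1)] snoc.prems(3)
    by (metis less_irrefl snoc_eq_iff_butlast sum_list.Nil)
  then obtain ls' b where ls: "ls = ls' @ [b]" by (metis rev_exhaust)
  have comp: "is_composition ks" "is_composition ls'"
    using snoc.prems(1,2) by (simp_all add: ls)
  have total: "sum_list ks + a = sum_list ls' + b"
    using snoc.prems(3) by (simp add: ls)
  have P: "(if ks = [] then {} else insert (sum_list ks) (proper_partial_sums ks)) =
      (if ls' = [] then {} else insert (sum_list ls') (proper_partial_sums ls'))"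
    using snoc.prems(4) by (simp only: ls proper_partial_sums_snoc)
  show ?case
  proof (cases "ks = []")
    case True
    then have "ls' = []" using P by (metis insert_not_empty)
    then show ?thesis using True total by (simp add: ls)
  next
    case False
    with P have ne: "ls' \<noteq> []" by (metis insert_not_empty)
    \<comment> \<open>The total of all parts but the last is the largest proper partial sum.\<close>
    have E: "insert (sum_list ks) (proper_partial_sums ks) = insert (sum_list ls') (proper_partial_sums ls')"
      using P False ne by (simp only: if_False)
    have lt: "i < sum_list ks" if "i \<in> proper_partial_sums ks" for i
      using proper_partial_sums_less[OF comp(1) that] by blast
    have lt': "i < sum_list ls'" if "i \<in> proper_partial_sums ls'" for i
      using proper_partial_sums_less[OF comp(2) that] by blast
    have s: "sum_list ks = sum_list ls'"
      using E lt lt' by (metis insertE insertI1 less_asym)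
    have "proper_partial_sums ks = proper_partial_sums ls'"
      using E s lt lt' by (metis insert_ident less_irrefl)
    then have "ks = ls'" using snoc.IH[of ls'] comp s by blast
    then show ?thesis using total by (simp add: ls)
  qed
qed

text \<open>
Unlike the definite description of the dual, this relation is symmetric, so each construction step
below serves for both members of the pair.
\<close>

definition dual_pair :: "nat list \<Rightarrow> nat list \<Rightarrow> bool" where
  "dual_pair m q \<longleftrightarrow> m \<noteq> [] \<and> q \<noteq> [] \<and> is_composition m \<and> is_composition q \<and> sum_list q = sum_list m \<and>
     proper_partial_sums m \<inter> proper_partial_sums q = {} \<and>
     proper_partial_sums m \<union> proper_partial_sums q = {1..<sum_list m}"

lemma dual_pair_sym: "dual_pair m q \<Longrightarrow> dual_pair q m"
  by (auto simp: dual_pair_def)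

lemma hoffman_dual_eqI:
  assumes "dual_pair m q"
  shows "hoffman_dual m = q"
  unfolding hoffman_dual_def
proof (rule the_equality)
  fix q' assume q': "is_composition q' \<and> sum_list q' = sum_list m \<and>
     proper_partial_sums m \<inter> proper_partial_sums q' = {} \<and>
     proper_partial_sums m \<union> proper_partial_sums q' = {1..<sum_list m}"
  then have "proper_partial_sums q' = proper_partial_sums q"
    using assms unfolding dual_pair_def by blast
  then show "q' = q" using q' assms unfolding dual_pair_def by (intro composition_eqI) auto
qed (use assms in \<open>auto simp: dual_pair_def\<close>)

lemma dual_pair_singleton: "dual_pair [1] [1]"
  by (auto simp: dual_pair_def is_composition_def proper_partial_sums_def)

text \<open>
Increasing the last part of \<open>m\<close> keeps its partial sums but moves the upper end of the interval up by
one. The new point is the old total, and appending a part \<open>1\<close> to \<open>q\<close> makes it a partial sum of \<open>q\<close>.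
\<close>

lemma dual_pair_snoc:
  assumes "dual_pair (m @ [a]) q"
  shows "dual_pair (m @ [Suc a]) (q @ [1])"
proof -
  have w: "sum_list m + a = sum_list q" "0 < sum_list q" "q \<noteq> []"
    using assms sum_list_pos_composition[of q] by (auto simp: dual_pair_def)
  have p: "proper_partial_sums (m @ [Suc a]) = proper_partial_sums (m @ [a])"
    by (simp add: proper_partial_sums_snoc)
  have "proper_partial_sums (m @ [a]) \<inter> proper_partial_sums q = {}"
    "proper_partial_sums (m @ [a]) \<union> proper_partial_sums q = {1..<sum_list q}"
    using assms by (auto simp: dual_pair_def)
  moreover have "{1..<sum_list m + Suc a} = insert (sum_list q) {1..<sum_list q}"
    using w by auto
  moreover have "proper_partial_sums (q @ [1]) = insert (sum_list q) (proper_partial_sums q)"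
    using w by (simp add: proper_partial_sums_snoc)
  moreover have "sum_list q \<notin> proper_partial_sums (m @ [a])"
    using proper_partial_sums_less[of "m @ [a]" "sum_list q"] assms
    by (auto simp: dual_pair_def)
  moreover have "is_composition (m @ [Suc a])" "is_composition (q @ [1])" "sum_list (q @ [1]) = sum_list (m @ [Suc a])"
    using assms w by (auto simp: dual_pair_def)
  ultimately show ?thesis
    unfolding dual_pair_def p by simp
qed

lemma dual_pair_snoc_one:
  assumes "dual_pair m (q @ [a])"
  shows "dual_pair (m @ [1]) (q @ [Suc a])"
  using assms dual_pair_snoc dual_pair_sym by blast

section \<open>Tail sums\<close>

text \<open>
This bound makes the weight \<open>sqrt n\<close> reproduce itself under summation against \<open>1/n\<close>. Nested harmonic
sums of any depth can therefore be controlled by one weight, with no logarithmic powers to track.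
\<close>

lemma sum_inverse_sqrt_le: "(\<Sum>l=1..n. 1 / sqrt (real l)) \<le> 2 * sqrt (real n)"
proof (induction n)
  case (Suc n)
  define a b where "a = sqrt (real n)" and "b = sqrt (real (Suc n))"
  have ab: "0 \<le> a" "0 < b" "b\<^sup>2 = a\<^sup>2 + 1" by (simp_all add: a_def b_def)
  \<comment> \<open>The increment satisfies \<open>2 (b - a) = 2 / (a + b) \<ge> 1 / b\<close>.\<close>
  have "a\<^sup>2 + (b\<^sup>2 - 1) \<ge> 2 * (a * b) - 1"
    using zero_le_power2[of "a - b"] by (simp add: power2_diff algebra_simps)
  then have "2 * (a * b) + 1 \<le> 2 * (b * b)" using ab(3) by (simp add: power2_eq_square)
  then have "2 * a + 1 / b \<le> 2 * b" using ab(2) by (simp add: field_simps)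
  then show ?case using Suc.IH by (simp add: a_def b_def)
qed simp

lemma sqrt_over_power_le:
  assumes "1 \<le> a"
  shows "sqrt (real l) / real l ^ a \<le> 1 / sqrt (real l)"
proof (cases "l = 0")
  case False
  have "real l ^ 1 \<le> real l ^ a" using False assms by (intro power_increasing) auto
  then have "sqrt (real l) / real l ^ a \<le> sqrt (real l) / real l"
    using False by (intro divide_left_mono) auto
  also have "\<dots> = 1 / sqrt (real l)" using False by (simp add: field_simps)
  finally show ?thesis .
qed simp

lemma sqrt_over_square: "sqrt (real l) / real l ^ 2 = real l powr (-3/2)"
proof (cases "l = 0")
  case False
  have "real l powr (1/2 - 2) = sqrt (real l) / real l ^ 2"
    using False by (subst powr_diff) (simp add: powr_half_sqrt)
  moreover have "(1/2 - 2 :: real) = -3/2" by simp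
  ultimately show ?thesis by metis
qed simp

definition tail :: "(nat \<Rightarrow> real) \<Rightarrow> nat \<Rightarrow> real" where
  "tail e l = (\<Sum>n. e (n + l))"

text \<open>
The adjoint, with respect to the pairing \<open>\<Sum>\<^sub>n e n * z n\<close>, of the operation that adds an outermost
summation with exponent \<open>j\<close> to a star sum \<open>z\<close>.
\<close>

definition star_step :: "nat \<Rightarrow> (nat \<Rightarrow> real) \<Rightarrow> nat \<Rightarrow> real" where
  "star_step j e l = tail e l / real l ^ j"

text \<open>
The class of coefficient sequences in which all interchanges of summation take place. The weight
\<open>sqrt n\<close> leaves room for one more harmonic summation, and the class is closed under \<open>star_step\<close>.
\<close>

definition sqrt_summable :: "(nat \<Rightarrow> real) \<Rightarrow> bool" where
  "sqrt_summable e \<longleftrightarrow> e 0 = 0 \<and> (\<forall>n. 0 \<le> e n) \<and> summable (\<lambda>n. e n * sqrt (real n))"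

lemma sqrt_summable_imp_summable:
  assumes "sqrt_summable e"
  shows "summable e"
proof (rule summable_comparison_test')
  show "summable (\<lambda>n. e n * sqrt (real n))" using assms by (simp add: sqrt_summable_def)
  show "norm (e n) \<le> e n * sqrt (real n)" for n
    using assms mult_left_mono[of 1 "sqrt (real n)" "e n"]
    by (cases "n = 0") (simp_all add: sqrt_summable_def)
qed

lemma tail_has_sum:
  assumes "\<And>n. 0 \<le> e n" "summable e"
  shows "(e has_sum tail e l) {l..}"
proof -
  have "summable (\<lambda>n. e (n + l))" using assms(2) by (rule summable_ignore_initial_segment)
  then have "((\<lambda>n. e (n + l)) has_sum tail e l) UNIV"
    using assms(1) unfolding tail_def by (intro norm_summable_imp_has_sum) (auto simp: summable_sums)
  moreover have bij: "bij_betw (\<lambda>n. n + l) UNIV {l..}"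
    by (rule bij_betwI[where g = "\<lambda>n. n - l"]) auto
  ultimately show ?thesis using has_sum_reindex_bij_betw[OF bij, of e] by blast
qed

lemma tail_nonneg: "(\<And>n. 0 \<le> e n) \<Longrightarrow> summable e \<Longrightarrow> 0 \<le> tail e l"
  unfolding tail_def by (intro suminf_nonneg summable_ignore_initial_segment)

lemma tail_rec:
  assumes "summable e"
  shows "tail e l = e l + tail e (Suc l)"
proof -
  have "summable (\<lambda>n. e (n + l))" using assms by (rule summable_ignore_initial_segment)
  from suminf_split_head[OF this] show ?thesis by (simp add: tail_def)
qed

lemma has_sum_Sigma_nonneg_iff:
  fixes f :: "'a \<times> 'b \<Rightarrow> real"
  assumes "\<And>x. x \<in> A \<Longrightarrow> ((\<lambda>y. f (x, y)) has_sum g x) (B x)" "\<And>p. 0 \<le> f p"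
  shows "(g has_sum S) A \<longleftrightarrow> (f has_sum S) (Sigma A B)"
proof
  assume g: "(g has_sum S) A"
  then have "f summable_on Sigma A B"
    using assms by (intro summable_on_SigmaI) (auto intro: has_sum_imp_summable)
  then show "(f has_sum S) (Sigma A B)" using assms(1) g by (intro has_sum_SigmaI) auto
next
  assume "(f has_sum S) (Sigma A B)"
  then show "(g has_sum S) A" using assms(1) by (rule has_sum_SigmaD)
qed

text \<open>
Tonelli's theorem on the triangle \<open>1 \<le> l \<le> n\<close>, stated as an equivalence because convergence has to
be transported in both directions.
\<close>

lemma tail_has_sum_swap:
  fixes e g :: "nat \<Rightarrow> real"
  assumes e: "\<And>n. 0 \<le> e n" "summable e" and g: "\<And>l. 0 \<le> g l"
  shows "((\<lambda>n. e n * (\<Sum>l=1..n. g l)) has_sum S) {1..} \<longleftrightarrow> ((\<lambda>l. tail e l * g l) has_sum S) {1..}"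
proof -
  define f where "f = (\<lambda>(n, l). e n * g l)"
  define f' where "f' = (\<lambda>(l, n). e n * g l)"
  have in1: "((\<lambda>l. f (n, l)) has_sum e n * (\<Sum>l=1..n. g l)) {1..n}" for n
    by (simp add: f_def has_sum_finite_iff sum_distrib_left)
  have in2: "((\<lambda>n. f' (l, n)) has_sum tail e l * g l) {l..}" for l
    unfolding f'_def prod.case by (intro has_sum_cmult_left tail_has_sum e)
  have bij: "bij_betw (\<lambda>(l, n). (n, l)) (SIGMA l:{1..}. {l..}) (SIGMA n:{1::nat..}. {1..n})"
    by (rule bij_betwI[where g = "\<lambda>(l, n). (n, l)"]) auto
  have eq: "(f has_sum S) (SIGMA n:{1..}. {1..n}) \<longleftrightarrow> (f' has_sum S) (SIGMA l:{1..}. {l..})"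
    using has_sum_reindex_bij_betw[OF bij, of f S] by (simp add: f_def f'_def case_prod_unfold)
  have pos: "0 \<le> f p" "0 \<le> f' p" for p using e g by (simp_all add: f_def f'_def case_prod_unfold)
  have "((\<lambda>n. e n * (\<Sum>l=1..n. g l)) has_sum S) {1..} \<longleftrightarrow> (f has_sum S) (SIGMA n:{1..}. {1..n})"
    by (rule has_sum_Sigma_nonneg_iff[OF in1 pos(1)])
  also have "\<dots> \<longleftrightarrow> ((\<lambda>l. tail e l * g l) has_sum S) {1..}"
    unfolding eq by (rule has_sum_Sigma_nonneg_iff[OF in2 pos(2), symmetric])
  finally show ?thesis .
qed

lemma has_sum_from_one_iff:
  fixes f :: "nat \<Rightarrow> real"
  assumes "f 0 = 0"
  shows "(f has_sum S) {1..} \<longleftrightarrow> (f has_sum S) UNIV"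
  using assms by (intro has_sum_cong_neutral) (auto simp: not_less_eq_eq)

lemma summable_nonneg_iff_has_sum:
  fixes f :: "nat \<Rightarrow> real"
  assumes "f 0 = 0" "\<And>n. 0 \<le> f n"
  shows "summable f \<longleftrightarrow> (\<exists>S. (f has_sum S) {1..})"
  unfolding has_sum_from_one_iff[where f = f, OF assms(1)]
proof
  assume "summable f"
  then have "(f has_sum suminf f) UNIV"
    using assms(2) by (intro norm_summable_imp_has_sum summable_sums) auto
  then show "\<exists>S. (f has_sum S) UNIV" by blast
next
  assume "\<exists>S. (f has_sum S) UNIV"
  then show "summable f" using has_sum_imp_sums sums_summable by blast
qed

text \<open>
After interchanging sums, the weighted series for \<open>star_step 1 e\<close> is the series of \<open>e n\<close> against
\<open>\<Sum>l=1..n. 1 / sqrt l\<close>, which is at most \<open>2 sqrt n\<close>.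
\<close>

lemma sqrt_summable_star_step:
  assumes e: "sqrt_summable e" and j: "1 \<le> j"
  shows "sqrt_summable (star_step j e)"
proof -
  have e': "\<And>n. 0 \<le> e n" "e 0 = 0" "summable (\<lambda>n. e n * sqrt (real n))"
    using e by (auto simp: sqrt_summable_def)
  note se = sqrt_summable_imp_summable[OF e]
  note t = tail_nonneg[OF e'(1) se]
  have "summable (\<lambda>n. e n * (\<Sum>l=1..n. 1 / sqrt (real l)))"
  proof (rule summable_comparison_test')
    show "summable (\<lambda>n. 2 * (e n * sqrt (real n)))" using e'(3) by (rule summable_mult)
    show "norm (e n * (\<Sum>l=1..n. 1 / sqrt (real l))) \<le> 2 * (e n * sqrt (real n))" for n
      using mult_left_mono[OF sum_inverse_sqrt_le[of n] e'(1)[of n]] e'(1)[of n]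
      by (simp add: sum_nonneg algebra_simps)
  qed
  then obtain S where "((\<lambda>n. e n * (\<Sum>l=1..n. 1 / sqrt (real l))) has_sum S) {1..}"
    by (subst (asm) summable_nonneg_iff_has_sum) (auto simp: e' sum_nonneg)
  then have "((\<lambda>l. tail e l * (1 / sqrt (real l))) has_sum S) {1..}"
    by (subst (asm) tail_has_sum_swap) (auto simp: e' se)
  then have s: "summable (\<lambda>l. tail e l * (1 / sqrt (real l)))"
    by (subst summable_nonneg_iff_has_sum) (auto simp: t)
  have "summable (\<lambda>l. star_step j e l * sqrt (real l))"
  proof (rule summable_comparison_test'[OF s])
    fix l :: nat
    show "norm (star_step j e l * sqrt (real l)) \<le> tail e l * (1 / sqrt (real l))"
    proof -
      have "tail e l * (sqrt (real l) / real l ^ j) \<le> tail e l * (1 / sqrt (real l))"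
        using t sqrt_over_power_le[OF j] by (intro mult_left_mono)
      then show ?thesis using t[of l] by (simp add: star_step_def)
    qed
  qed
  then show ?thesis using j t by (auto simp: sqrt_summable_def star_step_def)
qed

section \<open>Star sums as power series\<close>

lemma star_indices_Suc:
  "star_indices n (Suc r) = (\<Union>l\<in>{1..n}. (#) l ` star_indices l r)"
proof (intro set_eqI iffI)
  fix ns assume "ns \<in> star_indices n (Suc r)"
  then obtain l ns' where ns: "ns = l # ns'" "length ns' = r" "\<forall>y\<in>set ns'. y \<le> l"
     "sorted_wrt (\<ge>) ns'" "l \<in> {1..n}" "set ns' \<subseteq> {1..n}"
    by (cases ns) (auto simp: star_indices_def)
  then have "ns' \<in> star_indices l r" by (auto simp: star_indices_def)
  then show "ns \<in> (\<Union>l\<in>{1..n}. (#) l ` star_indices l r)" using ns by blast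
next
  fix ns assume "ns \<in> (\<Union>l\<in>{1..n}. (#) l ` star_indices l r)"
  then obtain l ns' where ns: "l \<in> {1..n}" "ns = l # ns'" "ns' \<in> star_indices l r" by blast
  then have "set ns' \<subseteq> {1..l}" by (simp add: star_indices_def)
  moreover have "{1..l} \<subseteq> {1..n}" using ns(1) by auto
  ultimately show "ns \<in> star_indices n (Suc r)"
    using ns by (auto simp: star_indices_def subset_iff)
qed

lemma star_indices_0: "star_indices n 0 = {[]}"
  by (auto simp: star_indices_def)

lemma finite_star_indices: "finite (star_indices n r)"
  by (induction r arbitrary: n) (auto simp: star_indices_0 star_indices_Suc)

lemma zeta_star_param_Nil: "zeta_star_param n [] x = x ^ n"
  by (simp add: zeta_star_param_def)

text \<open>
Splits off the largest summation index. The convention \<open>\<zeta>\<^sup>\<star>(\<emptyset>; x) = x\<^sup>n\<close> is exactly what makes this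
hold also when nothing remains.
\<close>

lemma zeta_star_param_Cons:
  "zeta_star_param n (j # q) x = (\<Sum>l=1..n. zeta_star_param l q x / real l ^ j)"
proof -
  define w where "w = (\<lambda>q ns. x ^ last ns / (\<Prod>i<length q. real (ns ! i) ^ (q ! i)))"
  have "zeta_star_param n (j # q) x = (\<Sum>ns\<in>(\<Union>l\<in>{1..n}. (#) l ` star_indices l (length q)). w (j # q) ns)"
    by (simp add: zeta_star_param_def w_def star_indices_Suc)
  also have "\<dots> = (\<Sum>l=1..n. \<Sum>ns\<in>(#) l ` star_indices l (length q). w (j # q) ns)"
    by (rule sum.UNION_disjoint) (auto simp: finite_star_indices)
  also have "\<dots> = (\<Sum>l=1..n. \<Sum>ns\<in>star_indices l (length q). w (j # q) (l # ns))"
    by (simp add: sum.reindex)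
  also have "\<dots> = (\<Sum>l=1..n. zeta_star_param l q x / real l ^ j)"
  proof (intro sum.cong refl)
    fix l
    have "w (j # q) (l # ns) = (if q = [] then x ^ l else w q ns) / real l ^ j"
      if "ns \<in> star_indices l (length q)" for ns
    proof -
      have "(\<Prod>i<length (j # q). real ((l # ns) ! i) ^ ((j # q) ! i)) =
          real l ^ j * (\<Prod>i<length q. real (ns ! i) ^ (q ! i))"
        by (simp add: prod.lessThan_Suc_shift del: prod.lessThan_Suc)
      moreover have "length ns = length q" using that by (simp add: star_indices_def)
      ultimately show ?thesis by (auto simp: w_def)
    qed
    then have "(\<Sum>ns\<in>star_indices l (length q). w (j # q) (l # ns)) =
        (\<Sum>ns\<in>star_indices l (length q). (if q = [] then x ^ l else w q ns) / real l ^ j)"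
      by (rule sum.cong[OF refl])
    then show "(\<Sum>ns\<in>star_indices l (length q). w (j # q) (l # ns)) = zeta_star_param l q x / real l ^ j"
      by (auto simp: zeta_star_param_def w_def star_indices_0 sum_divide_distrib)
  qed
  finally show ?thesis .
qed

lemma zeta_star_eq_param: "zeta_star n q = zeta_star_param n q 1"
  by (simp add: zeta_star_def zeta_star_param_def star_indices_0)

lemma zeta_star_param_nonneg: "0 \<le> x \<Longrightarrow> 0 \<le> zeta_star_param n q x"
  by (simp add: zeta_star_param_def sum_nonneg prod_nonneg)

text \<open>
Each part of \<open>q\<close> is moved from the star sum to the coefficient sequence by one interchange of
summation. When all parts have been moved, only the power of \<open>x\<close> is left.
\<close>

lemma has_sum_zeta_star_param:
  assumes "sqrt_summable e" "is_composition q" "0 \<le> x" "x \<le> 1"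
  shows "((\<lambda>n. e n * zeta_star_param n q x) has_sum (\<Sum>l. fold star_step q e l * x ^ l)) {1..}"
  using assms(1,2)
proof (induction q arbitrary: e)
  case Nil
  have e: "e 0 = 0" "\<And>n. 0 \<le> e n" using Nil by (auto simp: sqrt_summable_def)
  have "summable (\<lambda>n. norm (e n * x ^ n))"
  proof (rule summable_comparison_test'[OF sqrt_summable_imp_summable[OF Nil(1)]])
    show "norm (norm (e n * x ^ n)) \<le> e n" for n
      using assms e by (simp add: abs_mult mult_left_le power_le_one)
  qed
  then have "((\<lambda>n. e n * x ^ n) has_sum (\<Sum>l. e l * x ^ l)) UNIV"
    by (rule norm_summable_imp_has_sum[OF _ summable_sums[OF summable_norm_cancel]])
      (fact \<open>summable (\<lambda>n. norm (e n * x ^ n))\<close>)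
  then show ?case using e by (subst has_sum_from_one_iff) (auto simp: zeta_star_param_Nil)
next
  case (Cons j q)
  have j: "1 \<le> j" "is_composition q" using Cons.prems by (auto simp: is_composition_def)
  have e: "\<And>n. 0 \<le> e n" using Cons.prems by (auto simp: sqrt_summable_def)
  define g where "g l = zeta_star_param l q x / real l ^ j" for l
  have "((\<lambda>l. star_step j e l * zeta_star_param l q x) has_sum
      (\<Sum>l. fold star_step (j # q) e l * x ^ l)) {1..}"
    using Cons.IH[OF sqrt_summable_star_step[OF Cons.prems(1) j(1)] j(2)] by simp
  then have "((\<lambda>l. tail e l * g l) has_sum (\<Sum>l. fold star_step (j # q) e l * x ^ l)) {1..}"
    by (simp add: star_step_def g_def)
  then show ?case
    using e sqrt_summable_imp_summable[OF Cons.prems(1)] zeta_star_param_nonneg[OF assms(3)]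
    by (subst (asm) tail_has_sum_swap[symmetric]) (auto simp: zeta_star_param_Cons g_def)
qed

section \<open>Central binomial coefficients and the dual index\<close>

definition central :: "nat \<Rightarrow> real" where
  "central n = real ((2 * n) choose n) / 4 ^ n"

lemma central_bounds: "0 \<le> central n" "central n \<le> 1"
proof -
  have "(2 * n) choose n \<le> (\<Sum>k\<le>2 * n. (2 * n) choose k)"
    by (intro member_le_sum) auto
  also have "\<dots> = 4 ^ n" by (simp add: choose_row_sum power_mult)
  finally have "real ((2 * n) choose n) \<le> 4 ^ n" by (metis of_nat_le_iff of_nat_numeral of_nat_power)
  then show "0 \<le> central n" "central n \<le> 1" by (simp_all add: central_def)
qed

text \<open>
The coefficients \<open>e\<^sub>K\<close> of the left-hand side as a power series in \<open>x\<close>, for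
\<open>K = reverse_incr m @ replicate k 1\<close>. Indexing by \<open>K\<close> instead of by \<open>m\<close> and \<open>k\<close> treats the exponent
\<open>k + 2\<close> and the dual index uniformly: the recursion goes all the way down to \<open>a\<^sub>l / l\<close>.
\<close>

primrec central_coeff :: "nat list \<Rightarrow> nat \<Rightarrow> real" where
  "central_coeff [] = (\<lambda>l. central l / real l)"
| "central_coeff (a # K) = (star_step 1 ^^ (a - 1)) (\<lambda>l. central_coeff K l / real l)"

lemma central_coeff_Suc: "1 \<le> a \<Longrightarrow> central_coeff (Suc a # K) = star_step 1 (central_coeff (a # K))"
  by (cases a) auto

lemma central_coeff_replicate: "central_coeff (replicate k (Suc 0)) l = central l / real l ^ Suc k"
  by (induction k) auto

lemma sqrt_summable_central: "sqrt_summable (\<lambda>l. central l / real l / real l)"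
proof -
  have "summable (\<lambda>l. central l / real l / real l * sqrt (real l))"
  proof (rule summable_comparison_test')
    show "summable (\<lambda>l. real l powr (-3/2))" by (simp add: summable_real_powr_iff)
    show "norm (central l / real l / real l * sqrt (real l)) \<le> real l powr (-3/2)" for l
    proof -
      have "central l * (sqrt (real l) / real l ^ 2) \<le> 1 * (sqrt (real l) / real l ^ 2)"
        using central_bounds by (intro mult_right_mono) auto
      then show ?thesis
        using central_bounds[of l] unfolding sqrt_over_square[symmetric] by (simp add: power2_eq_square)
    qed
  qed
  then show ?thesis using central_bounds by (auto simp: sqrt_summable_def)
qed

lemma sqrt_summable_divide:
  assumes "sqrt_summable e"
  shows "sqrt_summable (\<lambda>l. e l / real l)"
proof -
  have e: "\<And>n. 0 \<le> e n" "summable (\<lambda>n. e n * sqrt (real n))"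
    using assms by (auto simp: sqrt_summable_def)
  have "summable (\<lambda>l. e l / real l * sqrt (real l))"
  proof (rule summable_comparison_test'[OF e(2)])
    fix l :: nat
    show "norm (e l / real l * sqrt (real l)) \<le> e l * sqrt (real l)"
    proof (cases "l = 0")
      case False
      then have "e l / real l \<le> e l / 1" using e(1) by (intro divide_left_mono) auto
      then have "e l / real l * sqrt (real l) \<le> e l * sqrt (real l)"
        by (intro mult_right_mono) auto
      then show ?thesis using e(1)[of l] by simp
    qed simp
  qed
  then show ?thesis using e by (auto simp: sqrt_summable_def)
qed

text \<open>
The empty composition has to be excluded: \<open>a\<^sub>l / l\<close> decays only like \<open>l\<close> to the power \<open>-3/2\<close>, so the weight
\<open>sqrt l\<close> makes its series diverge.
\<close>

lemma sqrt_summable_central_coeff: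
  "K \<noteq> [] \<Longrightarrow> sqrt_summable (central_coeff K)"
proof (induction K)
  case (Cons a K)
  have "sqrt_summable (\<lambda>l. central_coeff K l / real l)"
    using Cons.IH sqrt_summable_central sqrt_summable_divide by (cases "K = []") auto
  then have "sqrt_summable ((star_step 1 ^^ i) (\<lambda>l. central_coeff K l / real l))" for i
    by (induction i) (auto intro: sqrt_summable_star_step)
  then show ?case by simp
qed simp

lemma reverse_incr_snoc_Suc:
  "\<exists>b K. reverse_incr (m @ [a]) = b # K \<and> reverse_incr (m @ [Suc a]) = Suc b # K \<and> 1 \<le> b" if "1 \<le> a"
  using that by (cases m) (auto simp: reverse_incr_def)

lemma reverse_incr_snoc: "m \<noteq> [] \<Longrightarrow> reverse_incr (m @ [a]) = a # reverse_incr m"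
  by (cases m) (auto simp: reverse_incr_def)

text \<open>
A composition is built from \<open>[1]\<close> by appending ones and increasing the last part. The two moves act
on the dual with their roles exchanged, and on coefficients they are precisely the two kinds of step
in \<open>central_coeff\<close>.
\<close>

lemma fold_star_step_dual:
  assumes "is_composition m" "m \<noteq> []"
  shows "\<exists>q. dual_pair m q \<and> fold star_step q (central_coeff (replicate (Suc k) 1)) =
     central_coeff (reverse_incr m @ replicate k 1)"
  using assms
proof (induction m rule: rev_induct)
  case (snoc a m)
  have "1 \<le> a" using snoc.prems by simp
  then show ?case
  proof (induction a rule: nat_induct_at_least)
    case base
    show ?case
    proof (cases "m = []")
      case True
      have "fold star_step [1] (central_coeff (replicate (Suc k) 1)) =
          central_coeff (reverse_incr [1] @ replicate k 1)"
        by (simp add: reverse_incr_def)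
      then show ?thesis using dual_pair_singleton True by auto
    next
      case False
      then obtain q where q: "dual_pair m q" "fold star_step q (central_coeff (replicate (Suc k) 1)) =
        central_coeff (reverse_incr m @ replicate k 1)"
        using snoc by auto
      then obtain q' b where q': "q = q' @ [b]" by (metis dual_pair_def rev_exhaust)
      have "fold star_step (q' @ [Suc b]) e = (\<lambda>l. fold star_step (q' @ [b]) e l / real l)" for e
        by (simp add: star_step_def fun_eq_iff)
      then have "fold star_step (q' @ [Suc b]) (central_coeff (replicate (Suc k) 1)) =
         central_coeff (reverse_incr (m @ [1]) @ replicate k 1)"
        using q(2) False by (simp add: q' reverse_incr_snoc)
      then show ?thesis using dual_pair_snoc_one q(1) q' by blast
    qed
  next
    case (Suc a)
    then obtain q where q: "dual_pair (m @ [a]) q" "fold star_step q (central_coeff (replicate (Suc k) 1)) =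
        central_coeff (reverse_incr (m @ [a]) @ replicate k 1)" by blast
    obtain b K where K: "reverse_incr (m @ [a]) = b # K" "reverse_incr (m @ [Suc a]) = Suc b # K" "1 \<le> b"
      using reverse_incr_snoc_Suc[OF Suc(1)] by blast
    have "fold star_step (q @ [1]) (central_coeff (replicate (Suc k) 1)) =
        central_coeff (reverse_incr (m @ [Suc a]) @ replicate k 1)"
      using q(2) K(3) by (simp add: K central_coeff_Suc del: central_coeff.simps(2))
    then show ?case using dual_pair_snoc[OF q(1)] by blast
  qed
qed simp

lemma has_sum_zeta_star_dual:
  assumes "is_composition m" "m \<noteq> []" "0 \<le> x" "x \<le> 1"
  shows "((\<lambda>n. zeta_star_param n (hoffman_dual m) x / (real n ^ (k + 2) * 4 ^ n) * real ((2 * n) choose n))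
      has_sum (\<Sum>l. central_coeff (reverse_incr m @ replicate k 1) l * x ^ l)) {1..}"
proof -
  define e where "e = central_coeff (replicate (Suc k) 1)"
  have e: "sqrt_summable e" unfolding e_def by (rule sqrt_summable_central_coeff) simp
  obtain q where q: "dual_pair m q" "fold star_step q e = central_coeff (reverse_incr m @ replicate k 1)"
    using fold_star_step_dual[OF assms(1,2), of k] unfolding e_def by blast
  have "is_composition q" using q(1) unfolding dual_pair_def by blast
  from has_sum_zeta_star_param[OF e this assms(3,4)]
  have S: "((\<lambda>n. e n * zeta_star_param n (hoffman_dual m) x) has_sum
      (\<Sum>l. central_coeff (reverse_incr m @ replicate k 1) l * x ^ l)) {1..}"
    unfolding q(2) hoffman_dual_eqI[OF q(1)] .
  have "e n = central n / real n ^ (k + 2)" for n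
    unfolding e_def using central_coeff_replicate[of "Suc k" n] by (simp only: One_nat_def add_2_eq_Suc')
  then have "(\<lambda>n. e n * zeta_star_param n (hoffman_dual m) x) =
      (\<lambda>n. zeta_star_param n (hoffman_dual m) x / (real n ^ (k + 2) * 4 ^ n) * real ((2 * n) choose n))"
    by (simp add: central_def mult_ac)
  then show ?thesis using S by (simp only:)
qed

section \<open>Parity-restricted nested sums\<close>

text \<open>
Multiplication by \<open>s\<^sup>2 / (1 - s\<^sup>2)\<close> on power series coefficients.
\<close>

definition same_parity_sum :: "(nat \<Rightarrow> real) \<Rightarrow> nat \<Rightarrow> real" where
  "same_parity_sum b N = (\<Sum>l | l < N \<and> even (N + l). b l)"

text \<open>
If \<open>b\<close> are the coefficients of \<open>f(s\<^sup>2)\<close> in powers of \<open>s\<close>, where \<open>f(t)\<close> may involve half-integral powers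
of \<open>t\<close>, then \<open>li_step a b\<close> are those of the iterated integral of \<open>f\<close> that uses \<open>dt/(1 - t)\<close> once and
then \<open>dt/t\<close> another \<open>a - 1\<close> times; the factor \<open>2\<close> comes from \<open>dt/t = 2 ds/s\<close>.
\<close>

definition li_step :: "nat \<Rightarrow> (nat \<Rightarrow> real) \<Rightarrow> nat \<Rightarrow> real" where
  "li_step a b N = (2 / real N) ^ a * same_parity_sum b N"

definition li_steps :: "nat list \<Rightarrow> (nat \<Rightarrow> real) \<Rightarrow> nat \<Rightarrow> real" where
  "li_steps K b = foldr li_step K b"

definition powser :: "(nat \<Rightarrow> real) \<Rightarrow> real \<Rightarrow> real" where
  "powser b s = (\<Sum>N. b N * s ^ N)"

lemma li_steps_simps [simp]: "li_steps [] b = b" "li_steps (a # K) b = li_step a (li_steps K b)"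
  by (simp_all add: li_steps_def)

lemma same_parity_sum_0 [simp]: "same_parity_sum b 0 = 0"
  by (simp add: same_parity_sum_def)

text \<open>
Together with the value at \<open>0\<close> this is the initial condition for the two-step recursion that follows.
\<close>

lemma same_parity_sum_1 [simp]: "same_parity_sum b (Suc 0) = 0"
proof -
  have "{l. l < Suc 0 \<and> even (Suc 0 + l)} = {}" by (auto intro: odd_pos)
  then show ?thesis unfolding same_parity_sum_def by (metis sum.empty)
qed

lemma same_parity_sum_Suc_Suc: "same_parity_sum b (Suc (Suc N)) = same_parity_sum b N + b N"
proof -
  have "l < Suc (Suc N) \<and> even (Suc (Suc N) + l) \<longleftrightarrow> l = N \<or> l < N \<and> even (N + l)" for l
    by (auto simp: less_Suc_eq)
  then have "{l. l < Suc (Suc N) \<and> even (Suc (Suc N) + l)} = insert N {l. l < N \<and> even (N + l)}"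
    by blast
  then show ?thesis unfolding same_parity_sum_def by simp
qed

lemma abs_same_parity_sum_le: "\<bar>same_parity_sum b N\<bar> \<le> (\<Sum>l<N. \<bar>b l\<bar>)"
proof -
  have "\<bar>same_parity_sum b N\<bar> \<le> (\<Sum>l | l < N \<and> even (N + l). \<bar>b l\<bar>)"
    unfolding same_parity_sum_def by (rule sum_abs)
  also have "\<dots> \<le> (\<Sum>l<N. \<bar>b l\<bar>)" by (intro sum_mono2) auto
  finally show ?thesis .
qed

lemma sqrt_of_nat_le: "sqrt (real n) \<le> real n"
  by (rule real_le_lsqrt) (auto simp: power2_eq_square mult_le_cancel_left1)

text \<open>
A growth condition preserved by every \<open>li_step\<close>. It implies convergence inside the unit disc, and
after one step with \<open>a \<ge> 2\<close> also absolute convergence on the boundary.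
\<close>

definition sqrt_growth :: "(nat \<Rightarrow> real) \<Rightarrow> bool" where
  "sqrt_growth b \<longleftrightarrow> (\<exists>C\<ge>0. \<forall>N. (\<Sum>l<N. \<bar>b l\<bar>) \<le> C * sqrt (real N))"

lemma abs_li_step_le:
  assumes "\<forall>N. (\<Sum>l<N. \<bar>b l\<bar>) \<le> C * sqrt (real N)"
  shows "\<bar>li_step a b N\<bar> \<le> 2 ^ a * C * (sqrt (real N) / real N ^ a)"
proof -
  have "\<bar>li_step a b N\<bar> = 2 ^ a / real N ^ a * \<bar>same_parity_sum b N\<bar>"
    by (simp add: li_step_def abs_mult power_divide)
  also have "\<dots> \<le> 2 ^ a / real N ^ a * (C * sqrt (real N))"
    using abs_same_parity_sum_le[of b N] assms
    by (intro mult_left_mono order.trans[OF abs_same_parity_sum_le]) auto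
  finally show ?thesis by (simp add: mult_ac)
qed

lemma sqrt_growth_of_inverse_sqrt:
  assumes "\<And>l. \<bar>b l\<bar> \<le> C * (1 / sqrt (real l))" "0 \<le> C"
  shows "sqrt_growth b"
  unfolding sqrt_growth_def
proof (intro exI conjI allI)
  show "0 \<le> 2 * C" using assms by simp
  fix N
  have "(\<Sum>l<N. \<bar>b l\<bar>) \<le> (\<Sum>l<N. C * (1 / sqrt (real l)))"
    by (intro sum_mono assms)
  also have "\<dots> \<le> (\<Sum>l\<in>insert 0 {1..N}. C * (1 / sqrt (real l)))"
    using assms(2) by (intro sum_mono2) auto
  also have "\<dots> = C * (\<Sum>l=1..N. 1 / sqrt (real l))" by (simp add: sum_distrib_left)
  also have "\<dots> \<le> C * (2 * sqrt (real N))"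
    using assms(2) by (intro mult_left_mono sum_inverse_sqrt_le)
  finally show "(\<Sum>l<N. \<bar>b l\<bar>) \<le> 2 * C * sqrt (real N)" by simp
qed

lemma sqrt_growth_li_step:
  assumes "sqrt_growth b" "1 \<le> a"
  shows "sqrt_growth (li_step a b)"
proof -
  obtain C where C: "0 \<le> C" "\<forall>N. (\<Sum>l<N. \<bar>b l\<bar>) \<le> C * sqrt (real N)"
    using assms(1) unfolding sqrt_growth_def by blast
  have "\<bar>li_step a b l\<bar> \<le> 2 ^ a * C * (1 / sqrt (real l))" for l
    using abs_li_step_le[OF C(2)] mult_left_mono[OF sqrt_over_power_le[OF assms(2)]] C(1)
    by (meson order.trans mult_nonneg_nonneg zero_le_numeral zero_le_power)
  then show ?thesis by (rule sqrt_growth_of_inverse_sqrt) (use C in simp)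
qed

lemma sqrt_growth_li_steps: "sqrt_growth b \<Longrightarrow> is_composition K \<Longrightarrow> sqrt_growth (li_steps K b)"
proof (induction K)
  case (Cons a K)
  then have "1 \<le> a" "is_composition K" by (auto simp: is_composition_def)
  with Cons show ?case using sqrt_growth_li_step by simp
qed simp

lemma sqrt_growth_add:
  assumes "sqrt_growth b" "sqrt_growth c"
  shows "sqrt_growth (\<lambda>N. b N + c N)"
proof -
  obtain B C where B: "0 \<le> B" "\<forall>N. (\<Sum>l<N. \<bar>b l\<bar>) \<le> B * sqrt (real N)"
    and C: "0 \<le> C" "\<forall>N. (\<Sum>l<N. \<bar>c l\<bar>) \<le> C * sqrt (real N)"
    using assms unfolding sqrt_growth_def by blast
  show ?thesis unfolding sqrt_growth_def
  proof (intro exI conjI allI)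
    show "0 \<le> B + C" using B C by simp
    fix N
    have "(\<Sum>l<N. \<bar>b l + c l\<bar>) \<le> (\<Sum>l<N. \<bar>b l\<bar> + \<bar>c l\<bar>)" by (intro sum_mono) simp
    also have "\<dots> \<le> B * sqrt (real N) + C * sqrt (real N)"
      using B C by (simp add: sum.distrib add_mono)
    finally show "(\<Sum>l<N. \<bar>b l + c l\<bar>) \<le> (B + C) * sqrt (real N)" by (simp add: algebra_simps)
  qed
qed

lemma sqrt_growth_cmult:
  assumes "sqrt_growth b"
  shows "sqrt_growth (\<lambda>N. c * b N)"
proof -
  obtain B where B: "0 \<le> B" "\<forall>N. (\<Sum>l<N. \<bar>b l\<bar>) \<le> B * sqrt (real N)"
    using assms unfolding sqrt_growth_def by blast
  have "(\<Sum>l<N. \<bar>c * b l\<bar>) \<le> \<bar>c\<bar> * B * sqrt (real N)" for N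
    using mult_left_mono[OF B(2)[rule_format], of "\<bar>c\<bar>" N]
    by (simp add: abs_mult sum_distrib_left mult.assoc)
  then show ?thesis using B(1) unfolding sqrt_growth_def
    by (intro exI[of _ "\<bar>c\<bar> * B"]) auto
qed

lemma sqrt_growth_abs [simp]: "sqrt_growth (\<lambda>N. \<bar>b N\<bar>) \<longleftrightarrow> sqrt_growth b"
  by (simp add: sqrt_growth_def)

lemma summable_linear_growth:
  fixes b :: "nat \<Rightarrow> real"
  assumes "\<And>N. \<bar>b N\<bar> \<le> C * sqrt (real (Suc N))" "0 \<le> C" "\<bar>s\<bar> < 1"
  shows "summable (\<lambda>N. norm (b N * s ^ N))"
proof -
  have "summable (\<lambda>N. C * (of_nat (Suc N) * \<bar>s\<bar> ^ N))"
    using geometric_deriv_sums[of "\<bar>s\<bar>"] assms(3) by (intro summable_mult) (auto simp: sums_iff)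
  then show ?thesis
  proof (rule summable_comparison_test')
    fix N :: nat
    have "\<bar>b N\<bar> \<le> C * sqrt (real (Suc N))" by (rule assms)
    also have "\<dots> \<le> C * real (Suc N)"
      using assms(2) by (intro mult_left_mono sqrt_of_nat_le) auto
    finally have "\<bar>b N\<bar> * \<bar>s\<bar> ^ N \<le> C * real (Suc N) * \<bar>s\<bar> ^ N" by (intro mult_right_mono) auto
    then show "norm (norm (b N * s ^ N)) \<le> C * (of_nat (Suc N) * \<bar>s\<bar> ^ N)"
      by (simp add: abs_mult power_abs mult.assoc)
  qed
qed

lemma summable_sqrt_growth:
  assumes "sqrt_growth b" "\<bar>s\<bar> < 1"
  shows "summable (\<lambda>N. norm (b N * s ^ N))"
proof -
  obtain C where C: "0 \<le> C" "\<forall>N. (\<Sum>l<N. \<bar>b l\<bar>) \<le> C * sqrt (real N)"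
    using assms(1) unfolding sqrt_growth_def by blast
  have "\<bar>b N\<bar> \<le> C * sqrt (real (Suc N))" for N
  proof -
    have "\<bar>b N\<bar> \<le> (\<Sum>l<Suc N. \<bar>b l\<bar>)" by (rule member_le_sum) auto
    also have "\<dots> \<le> C * sqrt (real (Suc N))" using C(2) by blast
    finally show ?thesis .
  qed
  then show ?thesis using C(1) assms(2) by (rule summable_linear_growth)
qed

lemma summable_li_step:
  assumes "sqrt_growth b" "2 \<le> a"
  shows "summable (\<lambda>N. \<bar>li_step a b N\<bar>)"
proof -
  obtain C where C: "0 \<le> C" "\<forall>N. (\<Sum>l<N. \<bar>b l\<bar>) \<le> C * sqrt (real N)"
    using assms(1) unfolding sqrt_growth_def by blast
  have "summable (\<lambda>N. 2 ^ a * C * (real N powr (-3/2)))"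
    by (intro summable_mult) (simp add: summable_real_powr_iff)
  then show ?thesis
  proof (rule summable_comparison_test')
    fix N :: nat
    have "sqrt (real N) / real N ^ a \<le> real N powr (-3/2)"
    proof (cases "N = 0")
      case False
      have "real N ^ 2 \<le> real N ^ a" using False assms by (intro power_increasing) auto
      then show ?thesis
        using False unfolding sqrt_over_square[symmetric] by (intro divide_left_mono) auto
    qed (use assms in simp)
    then have "2 ^ a * C * (sqrt (real N) / real N ^ a) \<le> 2 ^ a * C * (real N powr (-3/2))"
      using C(1) by (intro mult_left_mono) auto
    then show "norm \<bar>li_step a b N\<bar> \<le> 2 ^ a * C * (real N powr (-3/2))"
      using abs_li_step_le[OF C(2), of a N] by simp
  qed
qed

text \<open>
The coefficients of the constant function \<open>1\<close>, the starting point for ordinary polylogarithms.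
\<close>

definition delta0 :: "nat \<Rightarrow> real" where "delta0 N = (if N = 0 then 1 else 0)"

text \<open>
The coefficients of \<open>-2 log (1 + s)\<close>; division by zero supplies the vanishing constant term.
\<close>

definition log_coeff :: "nat \<Rightarrow> real" where "log_coeff N = 2 * (-1) ^ N / real N"

lemma sums_delta0: "(\<lambda>N. delta0 N * s ^ N) sums 1"
  using sums_single[of 0 "\<lambda>_. 1 :: real"]
  by (simp add: delta0_def if_distrib if_distribR cong: if_cong)

lemma sqrt_growth_delta0: "sqrt_growth delta0"
  unfolding sqrt_growth_def
proof (intro exI conjI allI)
  show "(\<Sum>l<N. \<bar>delta0 l\<bar>) \<le> 1 * sqrt (real N)" for N
    by (cases N) (auto simp: delta0_def sum.lessThan_Suc_shift simp del: sum.lessThan_Suc)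
qed simp

lemma sqrt_growth_log_coeff: "sqrt_growth log_coeff"
proof (rule sqrt_growth_of_inverse_sqrt)
  fix l :: nat
  have "\<bar>log_coeff l\<bar> = 2 * (1 / real l)" by (simp add: log_coeff_def abs_mult power_abs)
  also have "1 / real l \<le> 1 / sqrt (real l)"
    by (cases "l = 0") (auto intro!: divide_left_mono sqrt_of_nat_le)
  finally show "\<bar>log_coeff l\<bar> \<le> 2 * (1 / sqrt (real l))" by simp
qed simp

lemma summable_same_parity_sum:
  assumes "sqrt_growth b" "\<bar>s\<bar> < 1"
  shows "summable (\<lambda>N. same_parity_sum b N * s ^ N)"
proof -
  obtain C where C: "0 \<le> C" "\<forall>N. (\<Sum>l<N. \<bar>b l\<bar>) \<le> C * sqrt (real N)"
    using assms(1) unfolding sqrt_growth_def by blast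
  have "\<bar>same_parity_sum b N\<bar> \<le> C * sqrt (real (Suc N))" for N
  proof -
    have "\<bar>same_parity_sum b N\<bar> \<le> C * sqrt (real N)"
      using abs_same_parity_sum_le[of b N] C(2) order.trans by blast
    also have "\<dots> \<le> C * sqrt (real (Suc N))" using C(1) by (intro mult_left_mono) auto
    finally show ?thesis .
  qed
  from summable_linear_growth[OF this C(1) assms(2)] show ?thesis by (rule summable_norm_cancel)
qed

lemma powser_same_parity_sum:
  assumes "sqrt_growth b" "\<bar>s\<bar> < 1"
  shows "(1 - s\<^sup>2) * powser (same_parity_sum b) s = s\<^sup>2 * powser b s"
proof -
  note sp = summable_same_parity_sum[OF assms]
  have sb: "summable (\<lambda>N. b N * s ^ N)"
    using summable_sqrt_growth[OF assms] by (rule summable_norm_cancel)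
  have "powser (same_parity_sum b) s = (\<Sum>N. same_parity_sum b (N + 2) * s ^ (N + 2))"
    using suminf_split_initial_segment[OF sp, of 2] by (simp add: powser_def numeral_2_eq_2)
  also have "\<dots> = (\<Sum>N. s\<^sup>2 * (same_parity_sum b N * s ^ N) + s\<^sup>2 * (b N * s ^ N))"
    by (simp add: same_parity_sum_Suc_Suc power2_eq_square algebra_simps)
  also have "\<dots> = s\<^sup>2 * powser (same_parity_sum b) s + s\<^sup>2 * powser b s"
    unfolding powser_def using sp sb by (simp add: suminf_add[symmetric] suminf_mult summable_mult)
  finally show ?thesis by (simp add: algebra_simps)
qed

text \<open>
The derivative is characterised through \<open>s * D\<close>, because multiplying by \<open>s\<close> avoids the index shift.
This determines \<open>D\<close> away from the origin, which is all that the differential equations need.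
\<close>

lemma powser_derivative:
  assumes "\<And>z. \<bar>z\<bar> < 1 \<Longrightarrow> summable (\<lambda>N. b N * z ^ N)" and "\<bar>s\<bar> < 1"
  obtains D where "(powser b has_field_derivative D) (at s)" "s * D = powser (\<lambda>N. real N * b N) s"
proof
  have "((\<lambda>z. \<Sum>N. b N * z ^ N) has_field_derivative (\<Sum>n. diffs b n * s ^ n)) (at s)"
    using assms by (intro termdiffs_strong'[of 1]) auto
  then show "(powser b has_field_derivative (\<Sum>n. diffs b n * s ^ n)) (at s)"
    unfolding powser_def[abs_def] .
  have sm: "summable (\<lambda>n. diffs b n * s ^ n)"
    using assms by (intro termdiff_converges[of s 1 b]) auto
  then have "s * (\<Sum>n. diffs b n * s ^ n) = (\<Sum>n. s * (diffs b n * s ^ n))"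
    by (rule suminf_mult[symmetric])
  also have eq: "(\<lambda>n. s * (diffs b n * s ^ n)) = (\<lambda>n. real (Suc n) * b (Suc n) * s ^ Suc n)"
    by (simp add: diffs_def mult_ac)
  also have "suminf \<dots> = powser (\<lambda>N. real N * b N) s"
  proof -
    have "summable (\<lambda>n. real (Suc n) * b (Suc n) * s ^ Suc n)"
      unfolding eq[symmetric] using sm by (rule summable_mult)
    then have "summable (\<lambda>n. real n * b n * s ^ n)"
      by (subst (asm) summable_Suc_iff)
    from suminf_split_head[OF this] show ?thesis by (simp add: powser_def)
  qed
  finally show "s * (\<Sum>n. diffs b n * s ^ n) = powser (\<lambda>N. real N * b N) s" .
qed

lemma continuous_on_powser:
  assumes "summable (\<lambda>N. \<bar>b N\<bar>)"
  shows "continuous_on {-1..1} (powser b)"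
proof -
  have "uniform_limit {-1..1} (\<lambda>n x. \<Sum>i<n. b i * x ^ i) (\<lambda>x. \<Sum>i. b i * x ^ i) sequentially"
  proof (rule Weierstrass_m_test)
    show "norm (b n * x ^ n) \<le> \<bar>b n\<bar>" if "x \<in> {-1..1}" for n x
      using that by (auto simp: abs_mult power_abs intro!: mult_left_le power_le_one)
  qed (fact assms)
  then show ?thesis unfolding powser_def[abs_def]
    by (rule uniform_limit_theorem[rotated]) (auto intro!: always_eventually continuous_on_sum continuous_on_mult continuous_on_power)
qed

section \<open>The generating function of the central binomial coefficients\<close>

text \<open>
Both sides equal the Pochhammer symbol of \<open>1/2\<close> divided by \<open>n!\<close>.
\<close>

lemma central_eq_gbinomial: "central n = (-1) ^ n * ((-1/2) gchoose n)"
proof -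
  have "real ((2 * n) choose n) = fact (2 * n) / (fact n * fact n)"
    using binomial_fact[of n "2 * n", where ?'a = real] by simp
  also have "fact (2 * n) = (4 ^ n * pochhammer (1/2) n * fact n :: real)"
    using fact_double[of n, where ?'a = real] by (simp add: power_mult)
  finally have "central n = pochhammer (1/2) n / fact n"
    by (simp add: central_def)
  then show ?thesis
    by (simp add: gbinomial_pochhammer)
qed

lemma powser_central:
  assumes "\<bar>x\<bar> < 1"
  shows "(\<lambda>n. central n * x ^ n) sums (1 / sqrt (1 - x))"
proof -
  have "(\<lambda>n. ((-1/2) gchoose n) * (-x) ^ n) sums (1 + (-x)) powr (-1/2)"
    by (rule gen_binomial_real) (use assms in simp)
  moreover have "((-1/2) gchoose n) * (-x) ^ n = central n * x ^ n" for n
    by (simp add: central_eq_gbinomial power_minus[of x])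
  moreover have "(1 + (-x)) powr (-1/2) = 1 / sqrt (1 - x)"
    using assms powr_minus_divide[of "1 - x" "1/2"] by (simp add: powr_half_sqrt)
  ultimately show ?thesis by simp
qed

lemma abs_one_minus_square_less_one: "0 < s \<Longrightarrow> s \<le> 1 \<Longrightarrow> \<bar>1 - s\<^sup>2\<bar> < (1::real)"
  using power_le_one[of s 2] zero_less_power[of s 2] by auto

lemma deriv_powser_one_minus_square:
  assumes e: "\<And>z. \<bar>z\<bar> < 1 \<Longrightarrow> summable (\<lambda>N. e N * z ^ N)" and s: "0 < s" "s \<le> 1"
  obtains D where "((\<lambda>s. powser e (1 - s\<^sup>2)) has_field_derivative (-2 * s * D)) (at s)"
    "(1 - s\<^sup>2) * D = powser (\<lambda>N. real N * e N) (1 - s\<^sup>2)"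
proof -
  obtain D where D: "(powser e has_field_derivative D) (at (1 - s\<^sup>2))"
    "(1 - s\<^sup>2) * D = powser (\<lambda>N. real N * e N) (1 - s\<^sup>2)"
    using powser_derivative[OF e abs_one_minus_square_less_one[OF s]] by blast
  have "((\<lambda>s. powser e (1 - s\<^sup>2)) has_field_derivative (D * (0 - 2 * s))) (at s)"
    by (rule DERIV_chain'[where f = "\<lambda>s. 1 - s\<^sup>2" and g = "powser e", OF _ D(1)])
      (auto intro!: derivative_eq_intros)
  then show ?thesis using that[of D] D(2) by (simp add: mult_ac)
qed

lemma summable_central_over:
  assumes "\<bar>x\<bar> < 1"
  shows "summable (\<lambda>l. central l / real l * x ^ l)"
proof (rule summable_comparison_test')
  show "summable (\<lambda>n. \<bar>x\<bar> ^ n)" using assms by (simp add: summable_geometric)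
  fix n :: nat
  have "central n / real n \<le> 1"
    using central_bounds[of n] by (cases "n = 0") (auto simp: divide_le_eq)
  then have "central n / real n * \<bar>x\<bar> ^ n \<le> 1 * \<bar>x\<bar> ^ n" by (intro mult_right_mono) auto
  then show "norm (central n / real n * x ^ n) \<le> \<bar>x\<bar> ^ n"
    using central_bounds[of n] by (simp add: abs_mult power_abs)
qed

text \<open>
The base of the recursion. Along \<open>x = 1 - s\<^sup>2\<close> the derivative of the left-hand side in \<open>s\<close> follows from
\<open>\<Sum>\<^sub>n a\<^sub>n x\<^sup>n = 1/s\<close> and cancels that of \<open>2 log (1 + s)\<close>. The constant is read off at \<open>s = 1\<close>, which
is \<open>x = 0\<close> and so lies inside the disc of convergence.
\<close>

lemma powser_central_over:
  assumes "0 < s" "s < 1"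
  shows "powser (\<lambda>l. central l / real l) (1 - s\<^sup>2) = 2 * ln 2 - 2 * ln (1 + s)"
proof -
  define f where "f s = powser (\<lambda>l. central l / real l) (1 - s\<^sup>2) + 2 * ln (1 + s)" for s
  have df: "(f has_field_derivative 0) (at u)" if u: "0 < u" "u < 1" for u
  proof -
    obtain D where D: "((\<lambda>s. powser (\<lambda>l. central l / real l) (1 - s\<^sup>2)) has_field_derivative (-2 * u * D)) (at u)"
      "(1 - u\<^sup>2) * D = powser (\<lambda>N. real N * (central N / real N)) (1 - u\<^sup>2)"
      by (rule deriv_powser_one_minus_square[of "\<lambda>l. central l / real l" u])
        (use summable_central_over u in auto)
    have "(\<lambda>n. central n * (1 - u\<^sup>2) ^ n) sums (1 / sqrt (1 - (1 - u\<^sup>2)))"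
      using u by (intro powser_central abs_one_minus_square_less_one) auto
    then have S: "(\<lambda>n. central n * (1 - u\<^sup>2) ^ n) sums (1 / u)" using u by simp
    have "(\<lambda>n. central n * (1 - u\<^sup>2) ^ n - (if n = 0 then 1 else 0)) sums (1 / u - 1)"
      using sums_diff[OF S sums_single[of 0 "\<lambda>_. 1"]] by simp
    moreover have "central n * (1 - u\<^sup>2) ^ n - (if n = 0 then 1 else 0) =
        real n * (central n / real n) * (1 - u\<^sup>2) ^ n" for n
      by (simp add: central_def)
    ultimately have "(1 - u\<^sup>2) * D = 1 / u - 1"
      unfolding D(2) powser_def by (simp add: sums_iff)
    then have "(1 - u) * ((1 + u) * D) = (1 - u) * (1 / u)"
      using u by (simp add: power2_eq_square field_simps)
    moreover have "1 - u \<noteq> 0" using u by simp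
    ultimately have "(1 + u) * D = 1 / u" by (simp only: mult_cancel_left) simp
    then have "u * D = 1 / (1 + u)" using u by (simp add: field_simps)
    then have z: "-2 * u * D + 2 * (1 / (1 + u)) = 0" by simp
    have "(f has_field_derivative (-2 * u * D + 2 * (1 / (1 + u)))) (at u)"
      unfolding f_def[abs_def]
      by (intro DERIV_add D(1) DERIV_cmult) (use u in \<open>auto intro!: derivative_eq_intros\<close>)
    then show ?thesis unfolding z .
  qed
  have cont: "continuous_on {s..1} f"
  proof (rule continuous_at_imp_continuous_on, rule ballI)
    fix u assume u: "u \<in> {s..1}"
    obtain D where D: "((\<lambda>s. powser (\<lambda>l. central l / real l) (1 - s\<^sup>2)) has_field_derivative (-2 * u * D)) (at u)"
      by (rule deriv_powser_one_minus_square[of "\<lambda>l. central l / real l" u])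
        (use summable_central_over u assms in auto)
    show "isCont f u" unfolding f_def[abs_def]
      using u assms by (intro continuous_intros DERIV_isCont[OF D]) auto
  qed
  have "f 1 = f s"
    using assms by (intro DERIV_isconst_end[OF _ cont df]) auto
  moreover have "f 1 = 2 * ln 2"
    using powser_zero[of "\<lambda>l. central l / real l"] by (simp add: f_def powser_def)
  ultimately show ?thesis by (simp add: f_def)
qed

lemma powser_log_coeff:
  assumes "\<bar>s\<bar> < 1"
  shows "powser log_coeff s = - 2 * ln (1 + s)"
proof -
  have "(\<lambda>n. - ((- s) ^ n) / real n) sums ln (1 + s)"
    using ln_series'[of s] assms by simp
  from sums_mult[OF this, of "-2"]
  have "(\<lambda>n. log_coeff n * s ^ n) sums (- 2 * ln (1 + s))"
    by (simp add: log_coeff_def power_minus[of s] mult_ac)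
  then show ?thesis by (simp add: powser_def sums_iff)
qed

section \<open>The differential equation in the square root\<close>

text \<open>
The values \<open>L\<^sub>K(1)\<close>. For the empty composition the number \<open>2 log 2\<close> is the limit of
\<open>2 log 2 - 2 log (1 + s)\<close> at \<open>s = 0\<close>; defining it by this limit avoids summing the series at \<open>x = 1\<close>.
\<close>

definition central_total :: "nat list \<Rightarrow> real" where
  "central_total K = (if K = [] then 2 * ln 2 else suminf (central_coeff K))"

text \<open>
The coefficients \<open>r\<^sub>K\<close> of \<open>L\<^sub>K(1 - s\<^sup>2)\<close> in powers of \<open>s\<close>.
\<close>

primrec sqrt_coeff :: "nat list \<Rightarrow> nat \<Rightarrow> real" where
  "sqrt_coeff [] = (\<lambda>N. central_total [] * delta0 N + log_coeff N)"
| "sqrt_coeff (a # K) = (\<lambda>N. central_total (a # K) * delta0 N + (-1) * li_step a (sqrt_coeff K) N)"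

lemma sqrt_growth_sqrt_coeff: "is_composition K \<Longrightarrow> sqrt_growth (sqrt_coeff K)"
proof (induction K)
  case Nil
  show ?case by (auto intro!: sqrt_growth_add sqrt_growth_cmult sqrt_growth_delta0 sqrt_growth_log_coeff)
next
  case (Cons a K)
  then have "1 \<le> a" "sqrt_growth (sqrt_coeff K)" by (auto simp: is_composition_def)
  then show ?case
    unfolding sqrt_coeff.simps by (intro sqrt_growth_add sqrt_growth_cmult sqrt_growth_delta0 sqrt_growth_li_step)
qed

lemma summable_sqrt_coeff:
  "is_composition K \<Longrightarrow> \<bar>s\<bar> < 1 \<Longrightarrow> summable (\<lambda>N. sqrt_coeff K N * s ^ N)"
  by (rule summable_norm_cancel) (intro summable_sqrt_growth sqrt_growth_sqrt_coeff)

lemma li_step_0 [simp]: "li_step a b 0 = 0"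
  by (simp add: li_step_def)

lemma central_coeff_nonneg: "0 \<le> central_coeff K l"
proof (cases "K = []")
  case True
  then show ?thesis using central_bounds by simp
next
  case False
  then show ?thesis using sqrt_summable_central_coeff unfolding sqrt_summable_def by blast
qed

lemma central_coeff_0: "central_coeff K 0 = 0"
proof (cases "K = []")
  case False
  then show ?thesis using sqrt_summable_central_coeff unfolding sqrt_summable_def by blast
qed simp

lemma summable_central_coeff: "K \<noteq> [] \<Longrightarrow> summable (central_coeff K)"
  using sqrt_summable_central_coeff sqrt_summable_imp_summable by blast

lemma summable_central_coeff_powser:
  assumes "K \<noteq> []" "\<bar>x\<bar> \<le> 1"
  shows "summable (\<lambda>l. central_coeff K l * x ^ l)"
proof (rule summable_comparison_test'[OF summable_central_coeff[OF assms(1)]])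
  show "norm (central_coeff K l * x ^ l) \<le> central_coeff K l" for l
    using assms(2) central_coeff_nonneg by (simp add: abs_mult power_abs mult_left_le power_le_one)
qed

lemma continuous_on_powser_central_coeff:
  "K \<noteq> [] \<Longrightarrow> continuous_on {-1..1} (powser (central_coeff K))"
  using summable_central_coeff central_coeff_nonneg by (intro continuous_on_powser) simp

text \<open>
Uniqueness for the differential equation: the difference of the two functions of \<open>s\<close> has derivative
zero inside the interval, is continuous, and vanishes at \<open>s = 0\<close> since both constants are
\<open>central_total K\<close>. The factor \<open>-2 u\<close> in the hypothesis is the inner derivative of \<open>1 - u\<^sup>2\<close>.
\<close>

lemma powser_central_coeff_eqI:
  assumes K: "K \<noteq> []" "is_composition K"
    and ode: "\<And>u D D'. 0 < u \<Longrightarrow> u < 1 \<Longrightarrow>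
      (1 - u\<^sup>2) * D = powser (\<lambda>N. real N * central_coeff K N) (1 - u\<^sup>2) \<Longrightarrow>
      u * D' = powser (\<lambda>N. real N * sqrt_coeff K N) u \<Longrightarrow> D' = -2 * u * D"
    and s: "0 \<le> s" "s < 1"
  shows "powser (central_coeff K) (1 - s\<^sup>2) = powser (sqrt_coeff K) s"
proof -
  define f where "f s = powser (central_coeff K) (1 - s\<^sup>2) - powser (sqrt_coeff K) s" for s
  note se = summable_central_coeff_powser[OF K(1)] and sr = summable_sqrt_coeff[OF K(2)]
  have df: "(f has_field_derivative 0) (at u)" if u: "0 < u" "u < 1" for u
  proof -
    obtain D where D: "((\<lambda>s. powser (central_coeff K) (1 - s\<^sup>2)) has_field_derivative (-2 * u * D)) (at u)"
      "(1 - u\<^sup>2) * D = powser (\<lambda>N. real N * central_coeff K N) (1 - u\<^sup>2)"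
      by (rule deriv_powser_one_minus_square[of "central_coeff K" u]) (use se u in auto)
    obtain D' where D': "(powser (sqrt_coeff K) has_field_derivative D') (at u)"
      "u * D' = powser (\<lambda>N. real N * sqrt_coeff K N) u"
      by (rule powser_derivative[of "sqrt_coeff K" u]) (use sr u in auto)
    have "(f has_field_derivative (-2 * u * D - D')) (at u)"
      unfolding f_def[abs_def] by (rule DERIV_diff[OF D(1) D'(1)])
    then show ?thesis using ode[OF u D(2) D'(2)] by simp
  qed
  have "f 0 = 0"
    using K powser_zero[of "sqrt_coeff K"]
    by (cases K) (auto simp: f_def powser_def central_total_def delta0_def)
  moreover have "f s = f 0" if "0 < s"
  proof (rule DERIV_isconst_end[OF that])
    have "continuous_on {0..s} (\<lambda>s. powser (central_coeff K) (1 - s\<^sup>2))"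
    proof (rule continuous_on_compose2[OF continuous_on_powser_central_coeff[OF K(1)]])
      show "(\<lambda>s. 1 - s\<^sup>2) ` {0..s} \<subseteq> {-1..1}"
      proof (rule image_subsetI)
        fix v assume "v \<in> {0..s}"
        then have "v\<^sup>2 \<le> 1" using s by (intro power_le_one) auto
        then show "1 - v\<^sup>2 \<in> {-1..1}" by simp
      qed
    qed (intro continuous_intros)
    moreover have "continuous_on {0..s} (powser (sqrt_coeff K))"
    proof (rule continuous_at_imp_continuous_on, rule ballI)
      fix u assume u: "u \<in> {0..s}"
      obtain D' where D': "(powser (sqrt_coeff K) has_field_derivative D') (at u)"
        by (rule powser_derivative[of "sqrt_coeff K" u]) (use sr u s in auto)
      then show "isCont (powser (sqrt_coeff K)) u" by (rule DERIV_isCont)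
    qed
    ultimately show "continuous_on {0..s} f" unfolding f_def[abs_def] by (rule continuous_on_diff)
  qed (use df s in auto)
  ultimately have "f s = 0" using s by (cases "s = 0") auto
  then show ?thesis by (simp add: f_def)
qed

text \<open>
The differential equation \<open>(1 - x) L'\<^bsub>a+1,K\<^esub> = L\<^bsub>a,K\<^esub>(1) - L\<^bsub>a,K\<^esub>\<close>, multiplied by \<open>x\<close>.
\<close>

lemma one_minus_mult_powser_star_step:
  assumes e: "\<And>n. 0 \<le> e n" "summable e" "e 0 = 0" and x: "0 \<le> x" "x < 1"
  shows "(1 - x) * powser (\<lambda>N. real N * star_step 1 e N) x = x * (suminf e - powser e x)"
proof -
  define t where "t = (\<lambda>N. if N = 0 then 0 else tail e N)"
  have t: "real N * star_step 1 e N = t N" for N by (simp add: star_step_def t_def)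
  have bound: "tail e N \<le> suminf e" for N
  proof (induction N)
    case 0
    show ?case by (simp add: tail_def)
  next
    case (Suc N)
    then show ?case using tail_rec[OF e(2), of N] e(1)[of N] by linarith
  qed
  have st: "summable (\<lambda>N. tail e N * x ^ N)"
  proof (rule summable_comparison_test')
    show "summable (\<lambda>N. suminf e * x ^ N)" using x by (intro summable_mult summable_geometric) simp
    show "norm (tail e N * x ^ N) \<le> suminf e * x ^ N" for N
      using tail_nonneg[OF e(1,2)] bound x by (simp add: abs_mult mult_right_mono)
  qed
  have tail_Suc: "tail e (Suc N) = tail e N - e N" for N
    using tail_rec[OF e(2), of N] by simp
  have se: "summable (\<lambda>N. e N * x ^ N)"
    by (rule summable_comparison_test'[OF e(2)]) (use e x in \<open>simp add: abs_mult mult_left_le power_le_one\<close>)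
  have st': "summable (\<lambda>N. tail e (Suc N) * x ^ N)"
  proof -
    have "(\<lambda>N. tail e (Suc N) * x ^ N) = (\<lambda>N. tail e N * x ^ N - e N * x ^ N)"
      by (simp only: tail_Suc left_diff_distrib)
    then show ?thesis using summable_diff[OF st se] by simp
  qed
  define T where "T = (\<Sum>N. tail e N * x ^ N)"
  \<comment> \<open>The generating function of the tails is computed in two ways: splitting off its first term, and using the recursion of the tails.\<close>
  have T1: "T = suminf e + x * (\<Sum>N. tail e (Suc N) * x ^ N)"
    using suminf_split_head[OF st] suminf_mult[OF st', of x]
    by (simp add: T_def tail_def mult_ac)
  have T2: "(\<Sum>N. tail e (Suc N) * x ^ N) = T - powser e x"
  proof -
    have "(\<lambda>N. tail e (Suc N) * x ^ N) = (\<lambda>N. tail e N * x ^ N - e N * x ^ N)"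
      by (simp only: tail_Suc left_diff_distrib)
    then show ?thesis using suminf_diff[OF st se] by (simp add: T_def powser_def)
  qed
  have P: "powser t x = T - suminf e"
  proof -
    have "t N * x ^ N = tail e N * x ^ N - (if N = 0 then suminf e else 0)" for N
      by (simp add: t_def tail_def)
    then have "(\<lambda>N. t N * x ^ N) sums (T - suminf e)"
      using sums_diff[OF summable_sums[OF st] sums_single[of 0 "\<lambda>_. suminf e"]] by (simp add: T_def)
    then show ?thesis by (simp add: powser_def sums_iff)
  qed
  show ?thesis using T1 unfolding t P T2 by (simp add: algebra_simps)
qed

lemma powser_cmult:
  "summable (\<lambda>N. b N * s ^ N) \<Longrightarrow> powser (\<lambda>N. c * b N) s = c * powser b s"
  unfolding powser_def by (simp add: mult.assoc suminf_mult)

text \<open>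
Induction on the number of parts and, inside it, on the first part. Each step
compares the derivatives of both sides. For the empty composition \<open>s = 0\<close> is excluded, because there
\<open>x = 1\<close> is on the boundary; the induction needs that case only for \<open>s > 0\<close>.
\<close>

theorem powser_central_coeff:
  assumes "is_composition K" "0 \<le> s" "s < 1" "K = [] \<Longrightarrow> 0 < s"
  shows "powser (central_coeff K) (1 - s\<^sup>2) = powser (sqrt_coeff K) s"
  using assms
proof (induction K arbitrary: s)
  case Nil
  have "powser (sqrt_coeff []) s = 2 * ln 2 + powser log_coeff s"
  proof -
    have "summable (\<lambda>N. log_coeff N * s ^ N)"
      using Nil by (intro summable_norm_cancel[OF summable_sqrt_growth] sqrt_growth_log_coeff) auto
    moreover have "(\<lambda>N. central_total [] * delta0 N * s ^ N) sums (2 * ln 2)"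
      using sums_mult[OF sums_delta0, of "2 * ln 2" s] by (simp add: central_total_def mult.assoc)
    ultimately have "(\<lambda>N. central_total [] * delta0 N * s ^ N + log_coeff N * s ^ N) sums (2 * ln 2 + powser log_coeff s)"
      unfolding powser_def by (intro sums_add summable_sums)
    then show ?thesis by (simp add: powser_def sums_iff distrib_right)
  qed
  then show ?case using Nil powser_central_over[of s] powser_log_coeff[of s] by simp
next
  case (Cons a K)
  have a: "1 \<le> a" and K: "is_composition K" using Cons.prems by (auto simp: is_composition_def)
  have comp: "is_composition (b # K)" if "1 \<le> b" for b using K that by (simp add: is_composition_def)
  note gK = sqrt_growth_sqrt_coeff[OF K]
  show ?case using a Cons.prems(2,3)
  proof (induction a arbitrary: s rule: nat_induct_at_least)
    case base
    show ?case
    proof (rule powser_central_coeff_eqI[OF _ comp[OF order.refl] _ base])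
      fix u D D' :: real
      assume u: "0 < u" "u < 1"
        and D: "(1 - u\<^sup>2) * D = powser (\<lambda>N. real N * central_coeff (1 # K) N) (1 - u\<^sup>2)"
        and D': "u * D' = powser (\<lambda>N. real N * sqrt_coeff (1 # K) N) u"
      have "real N * central_coeff (1 # K) N = central_coeff K N" for N
        using central_coeff_0[of K] by (cases "N = 0") auto
      then have D1: "(1 - u\<^sup>2) * D = powser (sqrt_coeff K) u"
        using Cons.IH[OF K, of u] u D by simp
      have "real N * sqrt_coeff (1 # K) N = -2 * same_parity_sum (sqrt_coeff K) N" for N
        by (cases "N = 0") (auto simp: delta0_def li_step_def)
      then have "powser (\<lambda>N. real N * sqrt_coeff (1 # K) N) u = -2 * powser (same_parity_sum (sqrt_coeff K)) u"
        using powser_cmult[OF summable_same_parity_sum[OF gK, of u], of "-2"] u by simp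
      then have "(1 - u\<^sup>2) * (u * D') = -2 * ((1 - u\<^sup>2) * powser (same_parity_sum (sqrt_coeff K)) u)"
        unfolding D' by simp
      also have "\<dots> = -2 * (u\<^sup>2 * ((1 - u\<^sup>2) * D))"
        using powser_same_parity_sum[OF gK, of u] u unfolding D1 by simp
      finally have "((1 - u\<^sup>2) * u) * D' = ((1 - u\<^sup>2) * u) * (-2 * u * D)"
        by (simp add: power2_eq_square algebra_simps)
      moreover have "(1 - u\<^sup>2) * u \<noteq> 0" using u abs_square_less_1[of u] by auto
      ultimately show "D' = -2 * u * D" using mult_left_cancel by blast
    qed simp
  next
    case (Suc a)
    have e: "\<And>n. 0 \<le> central_coeff (a # K) n" "summable (central_coeff (a # K))" "central_coeff (a # K) 0 = 0"
      using central_coeff_nonneg summable_central_coeff central_coeff_0 by blast+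
    show ?case
    proof (rule powser_central_coeff_eqI[OF _ comp _ Suc.prems])
      fix u D D' :: real
      assume u: "0 < u" "u < 1"
        and D: "(1 - u\<^sup>2) * D = powser (\<lambda>N. real N * central_coeff (Suc a # K) N) (1 - u\<^sup>2)"
        and D': "u * D' = powser (\<lambda>N. real N * sqrt_coeff (Suc a # K) N) u"
      have x: "0 \<le> 1 - u\<^sup>2" "1 - u\<^sup>2 < 1" "1 - u\<^sup>2 \<noteq> 0" using u abs_square_less_1[of u] by auto
      have IH: "powser (central_coeff (a # K)) (1 - u\<^sup>2) = powser (sqrt_coeff (a # K)) u"
        using Suc.IH u by simp
      have "u\<^sup>2 * ((1 - u\<^sup>2) * D) = (1 - u\<^sup>2) * (suminf (central_coeff (a # K)) - powser (central_coeff (a # K)) (1 - u\<^sup>2))"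
        using one_minus_mult_powser_star_step[OF e x(1,2)] unfolding D central_coeff_Suc[OF Suc.hyps] by simp
      then have "(1 - u\<^sup>2) * (u\<^sup>2 * D) = (1 - u\<^sup>2) * (central_total (a # K) - powser (sqrt_coeff (a # K)) u)"
        unfolding IH by (simp add: central_total_def mult_ac)
      then have D1: "u\<^sup>2 * D = central_total (a # K) - powser (sqrt_coeff (a # K)) u" using x(3) by simp
      have eq: "real N * sqrt_coeff (Suc a # K) N = 2 * (sqrt_coeff (a # K) N - central_total (a # K) * delta0 N)" for N
        by (cases "N = 0") (auto simp: delta0_def li_step_def)
      have "(\<lambda>N. 2 * (sqrt_coeff (a # K) N * u ^ N - (if N = 0 then central_total (a # K) else 0))) sums
          (2 * (powser (sqrt_coeff (a # K)) u - central_total (a # K)))"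
        unfolding powser_def using summable_sqrt_coeff[OF comp[OF Suc.hyps], of u] u
        by (intro sums_mult sums_diff summable_sums sums_single[of 0 "\<lambda>_. central_total (a # K)"]) auto
      moreover have "2 * (sqrt_coeff (a # K) N * u ^ N - (if N = 0 then central_total (a # K) else 0)) =
         real N * sqrt_coeff (Suc a # K) N * u ^ N" for N
        unfolding eq by (simp add: delta0_def algebra_simps)
      ultimately have "u * D' = 2 * (powser (sqrt_coeff (a # K)) u - central_total (a # K))"
        unfolding D' powser_def by (simp add: sums_iff)
      then have "u * D' = u * (-2 * u * D)" using D1 by (simp add: power2_eq_square algebra_simps)
      moreover have "u \<noteq> 0" using u by simp
      ultimately show "D' = -2 * u * D" using mult_left_cancel by blast
    qed auto
  qed
qed

section \<open>Splitting the coefficients\<close>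

lemma li_step_add: "li_step a (\<lambda>N. b N + c N) = (\<lambda>N. li_step a b N + li_step a c N)"
  by (simp add: li_step_def same_parity_sum_def sum.distrib distrib_left fun_eq_iff)

lemma li_step_cmult: "li_step a (\<lambda>N. c * b N) = (\<lambda>N. c * li_step a b N)"
  by (simp add: li_step_def same_parity_sum_def sum_distrib_left[symmetric] mult_ac fun_eq_iff)

lemma li_step_sum: "li_step a (\<lambda>N. \<Sum>i\<in>A. f i N) = (\<lambda>N. \<Sum>i\<in>A. li_step a (f i) N)"
proof -
  have "same_parity_sum (\<lambda>N. \<Sum>i\<in>A. f i N) = (\<lambda>N. \<Sum>i\<in>A. same_parity_sum (f i) N)"
    unfolding same_parity_sum_def by (intro ext sum.swap)
  then show ?thesis by (simp add: li_step_def sum_distrib_left fun_eq_iff)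
qed

text \<open>
Each unfolding of the recursion for \<open>sqrt_coeff\<close> contributes the constant of the remaining suffix and
a factor \<open>-1\<close>; by linearity the prefix already processed acts on \<open>delta0\<close>.
\<close>

lemma sqrt_coeff_expand:
  "sqrt_coeff K = (\<lambda>N. (\<Sum>i\<le>length K. ((-1) ^ i * central_total (drop i K)) * li_steps (take i K) delta0 N)
     + (-1) ^ length K * li_steps K log_coeff N)"
proof (induction K)
  case (Cons a K)
  have "li_step a (sqrt_coeff K) = (\<lambda>N. (\<Sum>i\<le>length K. ((-1) ^ i * central_total (drop i K)) * li_step a (li_steps (take i K) delta0) N)
     + (-1) ^ length K * li_step a (li_steps K log_coeff) N)"
    by (subst Cons.IH) (simp only: li_step_add li_step_sum li_step_cmult)
  then show ?case
    by (simp add: sum.atMost_Suc_shift sum_negf fun_eq_iff del: sum.atMost_Suc)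
qed simp

text \<open>
The points \<open>s\<close> at which every series attached to \<open>K\<close> converges absolutely: the half-open unit
interval, and the end point when the outermost exponent is at least \<open>2\<close>.
\<close>

definition converges_at :: "nat list \<Rightarrow> real \<Rightarrow> bool" where
  "converges_at K s \<longleftrightarrow> 0 \<le> s \<and> (s < 1 \<or> s = 1 \<and> K \<noteq> [] \<and> 2 \<le> hd K)"

lemma summable_li_steps:
  assumes "sqrt_growth b" "is_composition K" "converges_at K s"
  shows "summable (\<lambda>N. norm (li_steps K b N * s ^ N))"
proof (cases "s < 1")
  case True
  then show ?thesis
    using assms by (intro summable_sqrt_growth sqrt_growth_li_steps) (auto simp: converges_at_def)
next
  case False
  then obtain a K' where K: "K = a # K'" "2 \<le> a" "s = 1" "is_composition K'"
    using assms by (cases K) (auto simp: converges_at_def is_composition_def)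
  then show ?thesis using summable_li_step[OF sqrt_growth_li_steps[OF assms(1)]] by simp
qed

lemma converges_at_take: "converges_at K s \<Longrightarrow> 0 < i \<Longrightarrow> converges_at (take i K) s"
  by (cases K; cases i) (auto simp: converges_at_def)

lemma is_composition_take: "is_composition K \<Longrightarrow> is_composition (take i K)"
  using set_take_subset[of i K] by (auto simp: is_composition_def)

lemma powser_sqrt_coeff:
  assumes K: "is_composition K" "converges_at K s"
  shows "powser (sqrt_coeff K) s =
    (\<Sum>i\<le>length K. ((-1) ^ i * central_total (drop i K)) * powser (li_steps (take i K) delta0) s)
     + (-1) ^ length K * powser (li_steps K log_coeff) s"
proof -
  have 1: "(\<lambda>N. li_steps (take i K) delta0 N * s ^ N) sums powser (li_steps (take i K) delta0) s" for i
  proof (cases "i = 0")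
    case True
    then show ?thesis using sums_delta0[of s] by (simp add: powser_def sums_iff)
  next
    case False
    then show ?thesis unfolding powser_def
      using summable_norm_cancel[OF summable_li_steps[OF sqrt_growth_delta0 is_composition_take[OF K(1)] converges_at_take[OF K(2)]]]
      by (intro summable_sums) auto
  qed
  have 2: "(\<lambda>N. li_steps K log_coeff N * s ^ N) sums powser (li_steps K log_coeff) s"
    unfolding powser_def
    using summable_norm_cancel[OF summable_li_steps[OF sqrt_growth_log_coeff K]] by (rule summable_sums)
  have "(\<lambda>N. (\<Sum>i\<le>length K. ((-1) ^ i * central_total (drop i K)) * (li_steps (take i K) delta0 N * s ^ N)) +
     (-1) ^ length K * (li_steps K log_coeff N * s ^ N)) sums
    ((\<Sum>i\<le>length K. ((-1) ^ i * central_total (drop i K)) * powser (li_steps (take i K) delta0) s)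
     + (-1) ^ length K * powser (li_steps K log_coeff) s)"
    by (intro sums_add sums_sum sums_mult 1 2)
  moreover have "(\<Sum>i\<le>length K. ((-1) ^ i * central_total (drop i K)) * (li_steps (take i K) delta0 N * s ^ N)) +
     (-1) ^ length K * (li_steps K log_coeff N * s ^ N) = sqrt_coeff K N * s ^ N" for N
    by (simp add: sqrt_coeff_expand sum_distrib_right distrib_right mult.assoc)
  ultimately show ?thesis by (simp add: powser_def sums_iff)
qed

text \<open>
At \<open>s = 1\<close> both sides are limits from the left, the coefficients of the right-hand side being
absolutely summable there.
\<close>

lemma powser_central_coeff_closed:
  assumes K: "is_composition K" "K \<noteq> []" "converges_at K s"
  shows "powser (central_coeff K) (1 - s\<^sup>2) = powser (sqrt_coeff K) s"
proof (cases "s < 1")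
  case True
  then show ?thesis using assms by (intro powser_central_coeff) (auto simp: converges_at_def)
next
  case False
  then have s: "s = 1" and hd: "2 \<le> hd K" using K(3) by (auto simp: converges_at_def)
  obtain a K' where K': "K = a # K'" "2 \<le> a" "is_composition K'"
    using K hd by (cases K) (auto simp: is_composition_def)
  have "summable (\<lambda>N. \<bar>sqrt_coeff K N\<bar>)"
  proof (rule summable_comparison_test')
    have "summable (\<lambda>N. \<bar>central_total K\<bar> * delta0 N)"
      using sums_delta0[of 1] by (intro summable_mult) (simp add: sums_iff)
    then show "summable (\<lambda>N. \<bar>central_total K\<bar> * delta0 N + \<bar>li_step a (sqrt_coeff K') N\<bar>)"
      using summable_li_step[OF sqrt_growth_sqrt_coeff[OF K'(3)] K'(2)] by (rule summable_add)
    show "norm \<bar>sqrt_coeff K N\<bar> \<le> \<bar>central_total K\<bar> * delta0 N + \<bar>li_step a (sqrt_coeff K') N\<bar>" for N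
      by (simp add: K' delta0_def)
  qed
  then have c1: "continuous_on {0..1} (powser (sqrt_coeff K))"
    using continuous_on_powser continuous_on_subset by (metis atLeastatMost_subset_iff order.refl neg_le_0_iff_le zero_le_one)
  have c2: "continuous_on {0..1} (\<lambda>s. powser (central_coeff K) (1 - s\<^sup>2))"
  proof (rule continuous_on_compose2[OF continuous_on_powser_central_coeff[OF K(2)]])
    show "(\<lambda>s. 1 - s\<^sup>2) ` {0..1} \<subseteq> {-1..1::real}"
    proof (rule image_subsetI)
      fix v :: real assume "v \<in> {0..1}"
      then have "v\<^sup>2 \<le> 1" by (intro power_le_one) auto
      then show "1 - v\<^sup>2 \<in> {-1..1}" by simp
    qed
  qed (intro continuous_intros)
  have cl: "closure {0..<1::real} = {0..1}" by simp
  have "powser (central_coeff K) (1 - 1\<^sup>2) - powser (sqrt_coeff K) 1 = 0"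
  proof (rule continuous_constant_on_closure[where S = "{0..<1}" and a = 0 and x = 1
        and f = "\<lambda>s. powser (central_coeff K) (1 - s\<^sup>2) - powser (sqrt_coeff K) s"])
    show "continuous_on (closure {0..<1}) (\<lambda>s. powser (central_coeff K) (1 - s\<^sup>2) - powser (sqrt_coeff K) s)"
      unfolding cl by (rule continuous_on_diff[OF c2 c1])
    show "powser (central_coeff K) (1 - s\<^sup>2) - powser (sqrt_coeff K) s = 0" if "s \<in> {0..<1}" for s
      using powser_central_coeff[OF K(1), of s] that K(2) by auto
  qed (simp add: cl)
  then show ?thesis by (simp add: s)
qed

section \<open>Sums over decreasing chains\<close>

text \<open>
Nested sums with a general interaction \<open>\<phi> a n l\<close> between neighbouring indices \<open>n > l\<close>. They cover both
multiple polylogarithms, with \<open>1/n\<^sup>a\<close>, and iterated \<open>li_step\<close>, with a parity condition.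
\<close>

primrec chain_sum :: "(nat \<Rightarrow> nat \<Rightarrow> nat \<Rightarrow> real) \<Rightarrow> (nat \<Rightarrow> real) \<Rightarrow> nat list \<Rightarrow> nat \<Rightarrow> real" where
  "chain_sum \<phi> b [] = b"
| "chain_sum \<phi> b (a # K) = (\<lambda>n. \<Sum>l<n. \<phi> a n l * chain_sum \<phi> b K l)"

text \<open>
Here \<open>ns\<close> has one entry more than \<open>K\<close>: the innermost index carries only the weight \<open>b\<close>.
\<close>

definition chain_weight :: "(nat \<Rightarrow> nat \<Rightarrow> nat \<Rightarrow> real) \<Rightarrow> (nat \<Rightarrow> real) \<Rightarrow> nat list \<Rightarrow> nat list \<Rightarrow> real" where
  "chain_weight \<phi> b K ns = (\<Prod>i<length K. \<phi> (K ! i) (ns ! i) (ns ! Suc i)) * b (ns ! length K)"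

lemma chain_weight_Cons:
  "chain_weight \<phi> b (a # K) (n # ns) = \<phi> a n (ns ! 0) * chain_weight \<phi> b K ns"
  by (simp add: chain_weight_def prod.lessThan_Suc_shift del: prod.lessThan_Suc)

definition chains_from :: "nat \<Rightarrow> nat \<Rightarrow> nat list set" where
  "chains_from r n = {ns \<in> polylog_indices (Suc r). hd ns = n}"

lemma chains_from_0: "0 < n \<Longrightarrow> chains_from 0 n = {[n]}"
  by (auto simp: chains_from_def polylog_indices_def length_Suc_conv)

lemma chains_from_Suc:
  assumes "0 < n"
  shows "chains_from (Suc r) n = (\<Union>l\<in>{1..<n}. (#) n ` chains_from r l)"
proof (intro set_eqI iffI)
  fix ns assume "ns \<in> chains_from (Suc r) n"
  then obtain l ns' where ns: "ns = n # l # ns'" "n # l # ns' \<in> polylog_indices (Suc (Suc r))"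
    by (auto simp: chains_from_def polylog_indices_def length_Suc_conv)
  then have "l # ns' \<in> chains_from r l" "l \<in> {1..<n}"
    by (auto simp: chains_from_def polylog_indices_def)
  then show "ns \<in> (\<Union>l\<in>{1..<n}. (#) n ` chains_from r l)" using ns(1) by blast
next
  fix ns assume "ns \<in> (\<Union>l\<in>{1..<n}. (#) n ` chains_from r l)"
  then obtain l ns' where l: "l \<in> {1..<n}" "ns = n # ns'" "ns' \<in> chains_from r l" by blast
  then obtain ns'' where "ns' = l # ns''" "l # ns'' \<in> polylog_indices (Suc r)"
    by (auto simp: chains_from_def polylog_indices_def length_Suc_conv)
  then show "ns \<in> chains_from (Suc r) n"
    using l assms by (force simp: chains_from_def polylog_indices_def)
qed

lemma finite_chains_from: "0 < n \<Longrightarrow> finite (chains_from r n)"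
  by (induction r arbitrary: n) (auto simp: chains_from_0 chains_from_Suc)

lemma chains_from_nth_0: "ns \<in> chains_from r n \<Longrightarrow> ns ! 0 = n"
  by (auto simp: chains_from_def polylog_indices_def length_Suc_conv)

lemma sum_chain_weight:
  assumes "b 0 = 0" "0 < n"
  shows "(\<Sum>ns\<in>chains_from (length K) n. chain_weight \<phi> b K ns) = chain_sum \<phi> b K n"
  using assms(2)
proof (induction K arbitrary: n)
  case Nil
  then show ?case by (simp add: chains_from_0 chain_weight_def)
next
  case (Cons a K)
  have "(\<Sum>ns\<in>chains_from (length (a # K)) n. chain_weight \<phi> b (a # K) ns) =
    (\<Sum>ns\<in>(\<Union>l\<in>{1..<n}. (#) n ` chains_from (length K) l). chain_weight \<phi> b (a # K) ns)"
    using Cons.prems by (simp add: chains_from_Suc)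
  also have "\<dots> = (\<Sum>l\<in>{1..<n}. \<Sum>ns\<in>(#) n ` chains_from (length K) l. chain_weight \<phi> b (a # K) ns)"
  proof (rule sum.UNION_disjoint)
    show "\<forall>l\<in>{1..<n}. finite ((#) n ` chains_from (length K) l)"
      by (simp add: finite_chains_from)
    show "\<forall>l\<in>{1..<n}. \<forall>l'\<in>{1..<n}. l \<noteq> l' \<longrightarrow>
        (#) n ` chains_from (length K) l \<inter> (#) n ` chains_from (length K) l' = {}"
      by (auto simp: chains_from_def)
  qed simp
  also have "\<dots> = (\<Sum>l\<in>{1..<n}. \<Sum>ns\<in>chains_from (length K) l. \<phi> a n l * chain_weight \<phi> b K ns)"
    by (simp add: sum.reindex chain_weight_Cons chains_from_nth_0)
  also have "\<dots> = (\<Sum>l\<in>{1..<n}. \<phi> a n l * chain_sum \<phi> b K l)"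
    using Cons.IH by (intro sum.cong refl) (simp add: sum_distrib_left[symmetric])
  also have "\<dots> = (\<Sum>l<n. \<phi> a n l * chain_sum \<phi> b K l)"
  proof (rule sum.mono_neutral_left)
    have "chain_sum \<phi> b K 0 = 0" using assms(1) by (cases K) auto
    then show "\<forall>l\<in>{..<n} - {1..<n}. \<phi> a n l * chain_sum \<phi> b K l = 0"
      by (auto simp: not_less_eq_eq)
  qed auto
  finally show ?case by simp
qed

text \<open>
The unordered sum over all decreasing lists is fibred over the largest entry. Each fibre is finite,
and the nested sum of absolute values dominates, so the rearrangement is legitimate.
\<close>

lemma has_sum_chain_weight:
  fixes g :: "nat \<Rightarrow> real"
  assumes b: "b 0 = 0"
    and s: "summable (\<lambda>n. \<bar>g n\<bar> * chain_sum (\<lambda>a n l. \<bar>\<phi> a n l\<bar>) (\<lambda>n. \<bar>b n\<bar>) K n)"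
  shows "((\<lambda>ns. g (ns ! 0) * chain_weight \<phi> b K ns) has_sum (\<Sum>n. g n * chain_sum \<phi> b K n))
      (polylog_indices (Suc (length K)))"
proof -
  define \<phi>' where "\<phi>' = (\<lambda>a n l. \<bar>\<phi> a n l\<bar>)"
  define b' where "b' = (\<lambda>n. \<bar>b n\<bar>)"
  define f where "f = (\<lambda>(n, ns). g n * chain_weight \<phi> b K ns)"
  have cw: "\<bar>chain_weight \<phi> b K ns\<bar> = chain_weight \<phi>' b' K ns" for ns
    by (simp add: chain_weight_def \<phi>'_def b'_def abs_mult abs_prod)
  have b'0: "b' 0 = 0" using b by (simp add: b'_def)
  have c0: "chain_sum \<phi> b K 0 = 0" "chain_sum \<phi>' b' K 0 = 0" using b b'0 by (cases K; simp)+
  have le: "\<bar>chain_sum \<phi> b K' n\<bar> \<le> chain_sum \<phi>' b' K' n" for K' n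
  proof (induction K' arbitrary: n)
    case (Cons a K')
    have "\<bar>chain_sum \<phi> b (a # K') n\<bar> \<le> (\<Sum>l<n. \<bar>\<phi> a n l * chain_sum \<phi> b K' l\<bar>)"
      by simp
    also have "\<dots> \<le> chain_sum \<phi>' b' (a # K') n"
      using Cons by (auto simp: abs_mult \<phi>'_def intro!: sum_mono mult_left_mono)
    finally show ?case .
  qed (simp add: b'_def)
  have inner: "((\<lambda>ns. f (n, ns)) has_sum g n * chain_sum \<phi> b K n) (chains_from (length K) n)"
    if "n \<in> {1..}" for n
    using that b by (simp add: f_def has_sum_finite_iff finite_chains_from sum_distrib_left[symmetric] sum_chain_weight)
  have inner': "((\<lambda>ns. norm (f (n, ns))) has_sum \<bar>g n\<bar> * chain_sum \<phi>' b' K n) (chains_from (length K) n)"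
    if "n \<in> {1..}" for n
    using that b'0 by (simp add: f_def has_sum_finite_iff finite_chains_from sum_distrib_left[symmetric]
        sum_chain_weight abs_mult cw)
  have s': "summable (\<lambda>n. \<bar>g n\<bar> * chain_sum \<phi>' b' K n)" using s by (simp add: \<phi>'_def b'_def)
  have nn: "0 \<le> \<bar>g n\<bar> * chain_sum \<phi>' b' K n" for n
    using le[of K n] by (intro mult_nonneg_nonneg) auto
  obtain S where "((\<lambda>n. \<bar>g n\<bar> * chain_sum \<phi>' b' K n) has_sum S) {1..}"
    using s' nn by (subst (asm) summable_nonneg_iff_has_sum) (auto simp: c0)
  then have "(\<lambda>p. norm (f p)) summable_on (SIGMA n:{1..}. chains_from (length K) n)"
    using inner' by (intro summable_on_SigmaI) (auto intro: has_sum_imp_summable)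
  then have sm: "f summable_on (SIGMA n:{1..}. chains_from (length K) n)"
    by (rule abs_summable_summable)
  have "summable (\<lambda>n. norm (g n * chain_sum \<phi> b K n))"
    by (rule summable_comparison_test'[OF s']) (use le in \<open>simp add: abs_mult mult_left_mono\<close>)
  then have "((\<lambda>n. g n * chain_sum \<phi> b K n) has_sum (\<Sum>n. g n * chain_sum \<phi> b K n)) UNIV"
    by (rule norm_summable_imp_has_sum) (rule summable_sums[OF summable_norm_cancel], fact)
  then have "((\<lambda>n. g n * chain_sum \<phi> b K n) has_sum (\<Sum>n. g n * chain_sum \<phi> b K n)) {1..}"
    by (subst has_sum_from_one_iff) (auto simp: c0)
  then have F: "(f has_sum (\<Sum>n. g n * chain_sum \<phi> b K n)) (SIGMA n:{1..}. chains_from (length K) n)"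
    using inner sm by (intro has_sum_SigmaI) auto
  have bij: "bij_betw snd (SIGMA n:{1..}. chains_from (length K) n) (polylog_indices (Suc (length K)))"
    by (rule bij_betwI[where g = "\<lambda>ns. (hd ns, ns)"])
      (auto simp: chains_from_def polylog_indices_def length_Suc_conv)
  have "((\<lambda>p. g (snd p ! 0) * chain_weight \<phi> b K (snd p)) has_sum (\<Sum>n. g n * chain_sum \<phi> b K n))
     (SIGMA n:{1..}. chains_from (length K) n)"
    using F by (rule has_sum_cong[THEN iffD1, rotated]) (auto simp: f_def chains_from_nth_0)
  then show ?thesis
    by (subst (asm) has_sum_reindex_bij_betw[OF bij, of "\<lambda>ns. g (ns ! 0) * chain_weight \<phi> b K ns"])
qed

section \<open>Multiple polylogarithms as nested sums\<close>

lemma li_step_eq_sum: "li_step a b N = (\<Sum>l<N. (2 / real N) ^ a * (if even (N + l) then 1 else 0) * b l)"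
proof -
  have "same_parity_sum b N = (\<Sum>l<N. if even (N + l) then b l else 0)"
    unfolding same_parity_sum_def by (subst sum.inter_filter[symmetric]) (auto intro: sum.cong)
  then show ?thesis by (simp add: li_step_def sum_distrib_left mult.assoc if_distrib if_distribR cong: if_cong)
qed

definition parity_kernel :: "nat \<Rightarrow> nat \<Rightarrow> nat \<Rightarrow> real" where
  "parity_kernel a n l = (2 / real n) ^ a * (if even (n + l) then 1 else 0)"

definition plain_kernel :: "nat \<Rightarrow> nat \<Rightarrow> nat \<Rightarrow> real" where
  "plain_kernel a n l = 1 / real n ^ a"

lemma chain_sum_parity_kernel: "chain_sum parity_kernel b K = li_steps K b"
  by (induction K) (simp_all add: li_step_eq_sum parity_kernel_def fun_eq_iff)

lemma sum_even_less_double: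
  fixes n :: nat and f :: "nat \<Rightarrow> real"
  shows "(\<Sum>l | l < 2 * n \<and> even l. f l) = (\<Sum>l<n. f (2 * l))"
proof -
  have "{l. l < 2 * n \<and> even l} = (\<lambda>l. 2 * l) ` {..<n}" by (auto elim: evenE)
  then show ?thesis by (simp add: sum.reindex inj_on_def)
qed

text \<open>
At even indices the parity condition holds automatically along a chain and the powers of \<open>2\<close> cancel.
In terms of functions this is the substitution \<open>t = s\<^sup>2\<close>.
\<close>

lemma chain_sum_plain_kernel: "chain_sum plain_kernel (\<lambda>n. b (2 * n)) K n = li_steps K b (2 * n)"
proof (induction K arbitrary: n)
  case (Cons a K)
  have "li_steps (a # K) b (2 * n) = (1 / real n) ^ a * (\<Sum>l<n. li_steps K b (2 * l))"
    by (simp add: li_step_def same_parity_sum_def sum_even_less_double)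
  also have "\<dots> = chain_sum plain_kernel (\<lambda>n. b (2 * n)) (a # K) n"
    by (simp add: Cons.IH plain_kernel_def sum_distrib_left power_one_over)
  finally show ?case by simp
qed simp

lemma li_steps_odd: "odd n \<Longrightarrow> (\<And>n. odd n \<Longrightarrow> b n = 0) \<Longrightarrow> li_steps K b n = 0"
proof (induction K arbitrary: n)
  case (Cons a K)
  then have "li_steps K b l = 0" if "l \<in> {l. l < n \<and> even (n + l)}" for l
    using that by auto
  then show ?case by (simp add: li_step_def same_parity_sum_def)
qed simp

lemma li_steps_snoc: "li_steps (K @ [a]) b = li_steps K (li_step a b)"
  by (simp add: li_steps_def)

lemma li_step_delta0: "1 \<le> a \<Longrightarrow> li_step a delta0 N = (if even N then (2 / real N) ^ a else 0)"
proof -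
  assume "1 \<le> a"
  have "same_parity_sum delta0 N = (if 0 \<in> {l. l < N \<and> even (N + l)} then 1 else 0)"
    unfolding same_parity_sum_def delta0_def by (subst sum.delta) auto
  then show ?thesis using \<open>1 \<le> a\<close> by (auto simp: li_step_def)
qed

lemma chain_sum_reciprocal:
  assumes "1 \<le> a"
  shows "chain_sum plain_kernel (\<lambda>n. 1 / real n ^ a) K n = li_steps (K @ [a]) delta0 (2 * n)"
proof -
  have "(\<lambda>n. li_step a delta0 (2 * n)) = (\<lambda>n. 1 / real n ^ a)"
    using assms by (simp add: li_step_delta0 power_one_over)
  then show ?thesis unfolding li_steps_snoc using chain_sum_plain_kernel[of "li_step a delta0" K n] by simp
qed

lemma chain_weight_plain_kernel:
  "chain_weight plain_kernel (\<lambda>n. 1 / real n ^ a) K ns = 1 / (\<Prod>i<length (K @ [a]). real (ns ! i) ^ ((K @ [a]) ! i))"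
proof -
  have "(\<Prod>i<length K. 1 / real (ns ! i) ^ (K ! i)) = 1 / (\<Prod>i<length K. real (ns ! i) ^ (K ! i))"
    by (simp add: prod_dividef)
  moreover have "(\<Prod>i<length K. real (ns ! i) ^ ((K @ [a]) ! i)) = (\<Prod>i<length K. real (ns ! i) ^ (K ! i))"
    by (intro prod.cong) (auto simp: nth_append)
  ultimately show ?thesis by (simp add: chain_weight_def plain_kernel_def)
qed

lemma has_sum_plain_chain:
  assumes K: "is_composition (K @ [a])" "converges_at (K @ [a]) s"
  shows "((\<lambda>ns. s\<^sup>2 ^ (ns ! 0) / (\<Prod>i<length (K @ [a]). real (ns ! i) ^ ((K @ [a]) ! i)))
     has_sum powser (li_steps (K @ [a]) delta0) s) (polylog_indices (Suc (length K)))"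
proof -
  have a: "1 \<le> a" using K by simp
  define c where "c = li_steps (K @ [a]) delta0"
  have odd: "c n = 0" if "odd n" for n
    unfolding c_def using that by (rule li_steps_odd) (auto simp: delta0_def elim: oddE)
  have sm: "summable (\<lambda>N. c N * s ^ N)"
    using summable_norm_cancel[OF summable_li_steps[OF sqrt_growth_delta0 K]] by (simp add: c_def)
  have mono: "strict_mono (\<lambda>n::nat. 2 * n)" by (simp add: strict_mono_def)
  have z: "c n * s ^ n = 0" if "n \<notin> range (\<lambda>n. 2 * n)" for n
    using that odd by (metis evenE mult_zero_left rangeI)
  have sm2: "summable (\<lambda>n. c (2 * n) * s ^ (2 * n))"
    using summable_mono_reindex[OF mono, of "\<lambda>n. c n * s ^ n"] z sm by simp
  have p2: "powser c s = (\<Sum>n. c (2 * n) * s ^ (2 * n))"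
    unfolding powser_def using suminf_mono_reindex[OF mono, of "\<lambda>n. c n * s ^ n"] z by simp
  have eq: "s\<^sup>2 ^ n * chain_sum plain_kernel (\<lambda>n. 1 / real n ^ a) K n = c (2 * n) * s ^ (2 * n)" for n
    using a by (simp add: chain_sum_reciprocal c_def power_mult)
  have abs: "(\<lambda>a n l. \<bar>plain_kernel a n l\<bar>) = plain_kernel" by (simp add: plain_kernel_def fun_eq_iff)
  have "((\<lambda>ns. s\<^sup>2 ^ (ns ! 0) * chain_weight plain_kernel (\<lambda>n. 1 / real n ^ a) K ns) has_sum
     (\<Sum>n. s\<^sup>2 ^ n * chain_sum plain_kernel (\<lambda>n. 1 / real n ^ a) K n)) (polylog_indices (Suc (length K)))"
  proof (rule has_sum_chain_weight)
    show "1 / real 0 ^ a = 0" using a by simp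
    show "summable (\<lambda>n. \<bar>s\<^sup>2 ^ n\<bar> * chain_sum (\<lambda>a n l. \<bar>plain_kernel a n l\<bar>) (\<lambda>n. \<bar>1 / real n ^ a\<bar>) K n)"
      using sm2 by (simp add: abs eq)
  qed
  from this[unfolded eq, folded p2] show ?thesis unfolding chain_weight_plain_kernel c_def by simp
qed

text \<open>
Only even powers of \<open>s\<close> occur in the series on the right, and these form the usual power series of
the polylogarithm at \<open>s\<^sup>2\<close>.
\<close>

lemma multi_polylog1_eq_powser:
  assumes "is_composition K" "converges_at K s \<or> K = []"
  shows "multi_polylog1 K (s\<^sup>2) = powser (li_steps K delta0) s"
proof (cases K rule: rev_cases)
  case Nil
  then show ?thesis using sums_delta0[of s] by (simp add: multi_polylog1_def powser_def sums_iff)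
next
  case (snoc K' a)
  have "multi_polylog1 K (s\<^sup>2) = (\<Sum>\<^sub>\<infinity>ns\<in>polylog_indices (length K). s\<^sup>2 ^ hd ns / (\<Prod>i<length K. real (ns ! i) ^ (K ! i)))"
    using snoc by (simp add: multi_polylog1_def)
  also have "\<dots> = (\<Sum>\<^sub>\<infinity>ns\<in>polylog_indices (length K). s\<^sup>2 ^ (ns ! 0) / (\<Prod>i<length K. real (ns ! i) ^ (K ! i)))"
  proof (rule infsum_cong)
    fix ns assume "ns \<in> polylog_indices (length K)"
    then have "ns \<noteq> []" using snoc by (auto simp: polylog_indices_def)
    then show "s\<^sup>2 ^ hd ns / (\<Prod>i<length K. real (ns ! i) ^ (K ! i)) = s\<^sup>2 ^ (ns ! 0) / (\<Prod>i<length K. real (ns ! i) ^ (K ! i))"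
      by (simp add: hd_conv_nth)
  qed
  also have "\<dots> = powser (li_steps K delta0) s"
    using has_sum_plain_chain[of K' a s] assms snoc by (auto intro!: infsumI)
  finally show ?thesis .
qed

section \<open>The sum over signs\<close>

text \<open>
The arguments of the polylogarithms in the sum over signs, with \<open>s\<close> in place of \<open>sqrt (1 - x)\<close>.
\<close>

definition sign_args :: "nat \<Rightarrow> (nat \<Rightarrow> real) \<Rightarrow> real \<Rightarrow> real list" where
  "sign_args r \<sigma> s = (\<sigma> 1 * s) # map (\<lambda>i. \<sigma> i * \<sigma> (i + 1)) [1..<r] @ [- \<sigma> r]"

lemma sign_args_nth:
  assumes "1 \<le> r" "i \<le> r"
  shows "sign_args r \<sigma> s ! i = (if i = 0 then s else \<sigma> i) * (if i < r then \<sigma> (Suc i) else -1)"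
proof (cases i)
  case (Suc j)
  then show ?thesis using assms
    by (cases "i = r") (auto simp: sign_args_def nth_append)
qed (use assms in \<open>simp add: sign_args_def\<close>)

text \<open>
The sign \<open>\<sigma> i\<close> occurs in two neighbouring arguments, so it collects the exponents of two neighbouring
summation indices.
\<close>

lemma prod_sign_args:
  assumes "1 \<le> r"
  shows "(\<Prod>i<Suc r. (sign_args r \<sigma> s ! i) ^ (ns ! i)) =
    s ^ (ns ! 0) * (-1) ^ (ns ! r) * (\<Prod>i=1..r. \<sigma> i ^ (ns ! (i - 1) + ns ! i))"
proof -
  have "(\<Prod>i<Suc r. (sign_args r \<sigma> s ! i) ^ (ns ! i)) =
    (\<Prod>i<Suc r. (if i = 0 then s else \<sigma> i) ^ (ns ! i)) * (\<Prod>i<Suc r. (if i < r then \<sigma> (Suc i) else -1) ^ (ns ! i))"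
    using assms by (simp only: prod.distrib[symmetric] power_mult_distrib[symmetric])
      (intro prod.cong, auto simp: sign_args_nth)
  also have "(\<Prod>i<Suc r. (if i = 0 then s else \<sigma> i) ^ (ns ! i)) = s ^ (ns ! 0) * (\<Prod>i<r. \<sigma> (Suc i) ^ (ns ! Suc i))"
    by (subst prod.lessThan_Suc_shift) simp
  also have "(\<Prod>i<Suc r. (if i < r then \<sigma> (Suc i) else -1) ^ (ns ! i)) = (\<Prod>i<r. \<sigma> (Suc i) ^ (ns ! i)) * (-1) ^ (ns ! r)"
    by simp
  also have "(\<Prod>i=1..r. \<sigma> i ^ (ns ! (i - 1) + ns ! i)) = (\<Prod>i<r. \<sigma> (Suc i) ^ (ns ! i + ns ! Suc i))"
    by (rule prod.reindex_bij_witness[of _ Suc "\<lambda>i. i - 1"]) auto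
  ultimately show ?thesis by (simp add: power_add prod.distrib mult_ac)
qed

text \<open>
Summing over the signs is a product of independent sums \<open>1 + (-1)\<^sup>e\<close>, each of which is \<open>2\<close> or \<open>0\<close>
according to the parity of \<open>e\<close>: the average over signs projects onto chains of constant parity.
\<close>

lemma sum_sign_args:
  assumes "1 \<le> r"
  shows "(\<Sum>\<sigma>\<in>{1..r} \<rightarrow>\<^sub>E {1, -1}. \<Prod>i<Suc r. (sign_args r \<sigma> s ! i) ^ (ns ! i)) =
    s ^ (ns ! 0) * (-1) ^ (ns ! r) * (\<Prod>i<r. 2 * (if even (ns ! i + ns ! Suc i) then 1 else 0))"
proof -
  have "(\<Sum>\<sigma>\<in>{1..r} \<rightarrow>\<^sub>E {1, -1}. \<Prod>i<Suc r. (sign_args r \<sigma> s ! i) ^ (ns ! i)) =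
    s ^ (ns ! 0) * (-1) ^ (ns ! r) * (\<Sum>\<sigma>\<in>{1..r} \<rightarrow>\<^sub>E {1, -1::real}. \<Prod>i=1..r. \<sigma> i ^ (ns ! (i - 1) + ns ! i))"
    by (simp only: prod_sign_args[OF assms] sum_distrib_left)
  also have "(\<Sum>\<sigma>\<in>{1..r} \<rightarrow>\<^sub>E {1, -1::real}. \<Prod>i=1..r. \<sigma> i ^ (ns ! (i - 1) + ns ! i)) =
      (\<Prod>i=1..r. \<Sum>y\<in>{1, -1}. y ^ (ns ! (i - 1) + ns ! i))"
    by (rule prod_sum_PiE[symmetric]) auto
  also have "\<dots> = (\<Prod>i<r. \<Sum>y\<in>{1, -1::real}. y ^ (ns ! i + ns ! Suc i))"
    by (rule prod.reindex_bij_witness[of _ Suc "\<lambda>i. i - 1"]) auto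
  also have "\<dots> = (\<Prod>i<r. 2 * (if even (ns ! i + ns ! Suc i) then 1 else 0))"
    by (intro prod.cong refl) (auto simp: uminus_power_if)
  finally show ?thesis .
qed

lemma prod_power_nth: "(\<Prod>i<length K. c ^ (K ! i)) = (c::real) ^ sum_list K"
  by (simp add: power_sum[symmetric] sum_list_sum_nth atLeast0LessThan)

lemma has_sum_finite_sum:
  fixes f :: "'a \<Rightarrow> 'b \<Rightarrow> real"
  assumes "finite A" "\<And>a. a \<in> A \<Longrightarrow> (f a has_sum g a) B"
  shows "((\<lambda>x. \<Sum>a\<in>A. f a x) has_sum (\<Sum>a\<in>A. g a)) B"
  using assms by (induction A rule: finite_induct) (auto intro: has_sum_add has_sum_0)

text \<open>
Both sides are sums over the same decreasing lists and agree term by term: the factors \<open>2 / n\<close> of the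
iterated \<open>li_step\<close> account for \<open>2\<close> to the power \<open>sum_list K\<close>, the coefficient of the logarithm for one
more \<open>2\<close>, and the sum over signs for \<open>2\<close> to the power \<open>length K\<close>.
\<close>

lemma sum_signs_multi_polylog:
  assumes K: "is_composition K" "K \<noteq> []" "converges_at K s"
  shows "2 ^ Suc (sum_list K) * (\<Sum>\<sigma>\<in>{1..length K} \<rightarrow>\<^sub>E {1, -1}.
      multi_polylog (K @ [1]) (sign_args (length K) \<sigma> s)) = 2 ^ length K * powser (li_steps K log_coeff) s"
proof -
  define r where "r = length K"
  have r: "1 \<le> r" using K(2) by (cases K) (auto simp: r_def)
  define S where "S = ({1..r} \<rightarrow>\<^sub>E {1, -1::real})"
  define P where "P ns = (\<Prod>i<Suc r. real (ns ! i) ^ ((K @ [1]) ! i))" for ns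
  define f where "f \<sigma> ns = (\<Prod>i<Suc r. (sign_args r \<sigma> s ! i) ^ (ns ! i)) / P ns" for \<sigma> ns
  have s: "0 \<le> s" using K(3) by (simp add: converges_at_def)
  have fin: "finite S" by (auto simp: S_def intro: finite_PiE)
  have polylog: "multi_polylog (K @ [1]) (sign_args r \<sigma> s) = infsum (f \<sigma>) (polylog_indices (Suc r))" for \<sigma>
    by (simp add: multi_polylog_def f_def[abs_def] P_def r_def prod_dividef del: prod.lessThan_Suc)
  \<comment> \<open>Absolute convergence is that of the one-variable series at \<open>s\<close>, which is \<open>(sqrt s)\<^sup>2\<close>.\<close>
  have dom: "((\<lambda>ns. s ^ (ns ! 0) / P ns) has_sum powser (li_steps (K @ [1]) delta0) (sqrt s)) (polylog_indices (Suc r))"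
  proof -
    have "converges_at (K @ [1]) (sqrt s)" "is_composition (K @ [1])"
      using K by (auto simp: converges_at_def)
    from has_sum_plain_chain[OF this(2,1)] show ?thesis using s by (simp add: P_def r_def)
  qed
  have P0: "0 \<le> P ns" for ns by (simp add: P_def prod_nonneg)
  have f_sum: "(f \<sigma> has_sum infsum (f \<sigma>) (polylog_indices (Suc r))) (polylog_indices (Suc r))" if "\<sigma> \<in> S" for \<sigma>
  proof (intro has_sum_infsum abs_summable_summable[of "f \<sigma>"] Infinite_Sum.abs_summable_on_comparison_test')
    show "(\<lambda>ns. s ^ (ns ! 0) / P ns) summable_on polylog_indices (Suc r)"
      using dom by (rule has_sum_imp_summable)
    have "\<bar>\<sigma> i\<bar> = 1" if "i \<in> {1..r}" for i using \<open>\<sigma> \<in> S\<close> that by (auto simp: S_def PiE_def Pi_def)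
    then have "\<bar>\<Prod>i=1..r. \<sigma> i ^ e i\<bar> = 1" for e by (simp add: abs_prod power_abs)
    then show "norm (f \<sigma> ns) \<le> s ^ (ns ! 0) / P ns" for ns
      unfolding f_def prod_sign_args[OF r] using s P0 by (simp add: abs_mult power_abs)
  qed
  have total: "((\<lambda>ns. \<Sum>\<sigma>\<in>S. f \<sigma> ns) has_sum (\<Sum>\<sigma>\<in>S. multi_polylog (K @ [1]) (sign_args r \<sigma> s))) (polylog_indices (Suc r))"
    unfolding polylog using fin f_sum by (rule has_sum_finite_sum)
  have chain: "((\<lambda>ns. s ^ (ns ! 0) * chain_weight parity_kernel log_coeff K ns) has_sum powser (li_steps K log_coeff) s)
      (polylog_indices (Suc r))"
  proof -
    have abs: "(\<lambda>a n l. \<bar>parity_kernel a n l\<bar>) = parity_kernel" by (simp add: parity_kernel_def fun_eq_iff)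
    have g: "sqrt_growth (\<lambda>n. \<bar>log_coeff n\<bar>)" using sqrt_growth_log_coeff by simp
    have "summable (\<lambda>n. li_steps K (\<lambda>n. \<bar>log_coeff n\<bar>) n * s ^ n)"
      using summable_norm_cancel[OF summable_li_steps[OF g K(1,3)]] .
    then have "((\<lambda>ns. s ^ (ns ! 0) * chain_weight parity_kernel log_coeff K ns) has_sum
       (\<Sum>n. s ^ n * chain_sum parity_kernel log_coeff K n)) (polylog_indices (Suc (length K)))"
      using s by (intro has_sum_chain_weight) (simp_all add: abs chain_sum_parity_kernel mult.commute log_coeff_def)
    then show ?thesis by (simp add: chain_sum_parity_kernel powser_def r_def mult.commute)
  qed
  have "2 ^ Suc (sum_list K) * (\<Sum>\<sigma>\<in>S. f \<sigma> ns) = 2 ^ r * (s ^ (ns ! 0) * chain_weight parity_kernel log_coeff K ns)" for ns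
  proof -
    define E where "E = (\<Prod>i<r. if even (ns ! i + ns ! Suc i) then 1 else 0 :: real)"
    define Q where "Q = (\<Prod>i<r. real (ns ! i) ^ (K ! i))"
    have "P ns = Q * real (ns ! r)"
    proof -
      have "(\<Prod>i<r. real (ns ! i) ^ ((K @ [1]) ! i)) = Q"
        unfolding Q_def by (intro prod.cong) (auto simp: nth_append r_def)
      then show ?thesis by (simp add: P_def r_def)
    qed
    moreover have "(\<Sum>\<sigma>\<in>S. f \<sigma> ns) = s ^ (ns ! 0) * (-1) ^ (ns ! r) * (2 ^ r * E) / P ns"
      unfolding f_def S_def E_def sum_divide_distrib[symmetric] sum_sign_args[OF r]
      by (simp only: prod.distrib) simp
    moreover have "chain_weight parity_kernel log_coeff K ns = 2 ^ sum_list K / Q * E * (2 * (-1) ^ (ns ! r) / real (ns ! r))"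
      unfolding chain_weight_def parity_kernel_def power_divide prod.distrib prod_dividef prod_power_nth
      by (simp only: E_def Q_def r_def log_coeff_def)
    ultimately show ?thesis by simp
  qed
  then have "((\<lambda>ns. 2 ^ r * (s ^ (ns ! 0) * chain_weight parity_kernel log_coeff K ns)) has_sum
      2 ^ Suc (sum_list K) * (\<Sum>\<sigma>\<in>S. multi_polylog (K @ [1]) (sign_args r \<sigma> s))) (polylog_indices (Suc r))"
    using has_sum_cmult_right[OF total, of "2 ^ Suc (sum_list K)"] by simp
  moreover have "((\<lambda>ns. 2 ^ r * (s ^ (ns ! 0) * chain_weight parity_kernel log_coeff K ns)) has_sum
      2 ^ r * powser (li_steps K log_coeff) s) (polylog_indices (Suc r))"
    by (rule has_sum_cmult_right[OF chain])
  ultimately show ?thesis unfolding S_def r_def by (rule has_sum_unique)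
qed

section \<open>The evaluation\<close>

lemma is_composition_reverse_incr:
  assumes "is_composition m"
  shows "is_composition (reverse_incr m @ replicate k 1)"
  using assms by (cases m) (auto simp: is_composition_def reverse_incr_def)

lemma reverse_incr_drop:
  assumes "1 \<le> j" "j \<le> length m"
  shows "drop (length m - j) (reverse_incr m) = reverse_incr (take j m)"
    "take (length m - j) (reverse_incr m) = rev (drop j m)"
  using assms
  by (cases m; cases j; auto simp: reverse_incr_def drop_rev take_rev)+

lemma length_reverse_incr: "m \<noteq> [] \<Longrightarrow> length (reverse_incr m) = length m"
  by (cases m) (auto simp: reverse_incr_def)

lemma sum_list_reverse_incr: "m \<noteq> [] \<Longrightarrow> sum_list (reverse_incr m) = Suc (sum_list m)"
  by (cases m) (auto simp: reverse_incr_def)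

lemma central_total_eq_infsum_zeta_star:
  assumes "is_composition m" "m \<noteq> []"
  shows "central_total (reverse_incr m @ replicate k 1) =
    (\<Sum>\<^sub>\<infinity>n\<in>{1..}. zeta_star n (hoffman_dual m) / (real n ^ (k + 2) * 4 ^ n) * real ((2 * n) choose n))"
proof -
  have "central_total (reverse_incr m @ replicate k 1) = (\<Sum>l. central_coeff (reverse_incr m @ replicate k 1) l * 1 ^ l)"
    by (simp add: central_total_def reverse_incr_def)
  then show ?thesis
    using has_sum_zeta_star_dual[OF assms, of 1 k] unfolding zeta_star_eq_param by (simp add: infsumI)
qed

lemma central_total_replicate:
  assumes "1 \<le> j"
  shows "central_total (replicate j 1) = (\<Sum>\<^sub>\<infinity>n\<in>{1..}. real ((2 * n) choose n) / (real n ^ (j + 1) * 4 ^ n))"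
proof -
  have ne: "replicate j 1 \<noteq> ([] :: nat list)" using assms by simp
  have "(central_coeff (replicate j 1) has_sum central_total (replicate j 1)) UNIV"
    using summable_central_coeff[OF ne] central_coeff_nonneg ne unfolding central_total_def
    by (simp only: if_False) (intro norm_summable_imp_has_sum summable_sums, simp_all)
  then have "(central_coeff (replicate j 1) has_sum central_total (replicate j 1)) {1..}"
    by (subst has_sum_from_one_iff) (auto simp: central_coeff_0)
  then have "central_total (replicate j 1) = infsum (central_coeff (replicate j 1)) {1..}"
    by (simp add: infsumI)
  also have "\<dots> = (\<Sum>\<^sub>\<infinity>n\<in>{1..}. real ((2 * n) choose n) / (real n ^ (j + 1) * 4 ^ n))"
  proof (rule infsum_cong)
    fix n :: nat
    show "central_coeff (replicate j 1) n = real ((2 * n) choose n) / (real n ^ (j + 1) * 4 ^ n)"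
      using central_coeff_replicate[of j n] by (simp add: central_def mult_ac)
  qed
  finally show ?thesis .
qed

text \<open>
Separates the cuts of \<open>K\<close> that fall inside \<open>reverse_incr m\<close>, the empty suffix, and the suffixes
consisting of ones; the reflection matches the order of summation in the final formula.
\<close>

lemma sum_atMost_split_reflect:
  fixes f :: "nat \<Rightarrow> real"
  shows "(\<Sum>i\<le>p + k. f i) = (\<Sum>j=1..p. f (p - j)) + f (p + k) + (\<Sum>j=1..k. f (p + k - j))"
proof -
  have "{..p + k} = {..<p} \<union> ({p..<p + k} \<union> {p + k})" by auto
  then have "(\<Sum>i\<le>p + k. f i) = (\<Sum>i<p. f i) + ((\<Sum>i=p..<p + k. f i) + f (p + k))"
    by (simp only:) (subst sum.union_disjoint; auto)+
  moreover have "(\<Sum>i<p. f i) = (\<Sum>j=1..p. f (p - j))"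
    by (rule sum.reindex_bij_witness[of _ "\<lambda>j. p - j" "\<lambda>i. p - i"]) auto
  moreover have "(\<Sum>i=p..<p + k. f i) = (\<Sum>j=1..k. f (p + k - j))"
    by (rule sum.reindex_bij_witness[of _ "\<lambda>j. p + k - j" "\<lambda>i. p + k - i"]) auto
  ultimately show ?thesis by simp
qed

lemma powser_central_coeff_expansion:
  fixes m :: "nat list" and k :: nat and t :: real
  defines "K \<equiv> reverse_incr m @ replicate k 1"
  assumes m: "is_composition m" "m \<noteq> []" and t: "0 \<le> t" "t \<le> 1"
    and conv: "converges_at K (sqrt (1 - t))"
  defines "p \<equiv> length m"
  shows "powser (central_coeff K) t =
     (\<Sum>j=1..p. (-1) ^ (p - j) * multi_polylog1 (rev (drop j m)) (1 - t) *
            (\<Sum>\<^sub>\<infinity>n\<in>{1..}. zeta_star n (hoffman_dual (take j m)) / (real n ^ (k + 2) * 4 ^ n)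
                           * real ((2 * n) choose n)))
         + (-1) ^ (p + k) * (2 * ln 2) * multi_polylog1 (reverse_incr m @ replicate k 1) (1 - t)
         + (\<Sum>j=1..k. (-1) ^ (p + k - j) *
              multi_polylog1 (reverse_incr m @ replicate (k - j) 1) (1 - t) *
              (\<Sum>\<^sub>\<infinity>n\<in>{1..}. real ((2 * n) choose n) / (real n ^ (j + 1) * 4 ^ n)))
         + (-1) ^ (p + k) * 2 ^ (sum_list m + 2 - p) *
            (\<Sum>\<sigma>\<in>{1..p + k} \<rightarrow>\<^sub>E {1, -1}.
               multi_polylog (reverse_incr m @ replicate (k + 1) 1)
                 ((\<sigma> 1 * sqrt (1 - t)) # map (\<lambda>i. \<sigma> i * \<sigma> (i + 1)) [1..<p + k]
                    @ [- \<sigma> (p + k)]))"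
proof -
  define s where "s = sqrt (1 - t)"
  have s2: "s\<^sup>2 = 1 - t" using t by (simp add: s_def)
  have K: "is_composition K" "K \<noteq> []"
    unfolding K_def by (rule is_composition_reverse_incr[OF m(1)]) (simp add: reverse_incr_def)
  have len: "length K = p + k" using length_reverse_incr[OF m(2)] by (simp add: K_def p_def)
  have conv': "converges_at K s" using conv by (simp add: s_def)
  \<comment> \<open>\<open>F i\<close> belongs to the cut of \<open>K\<close> after its first \<open>i\<close> parts.\<close>
  define F where "F i = (-1) ^ i * central_total (drop i K) * powser (li_steps (take i K) delta0) s" for i
  have li: "powser (li_steps (take i K) delta0) s = multi_polylog1 (take i K) (1 - t)" for i
    using multi_polylog1_eq_powser[OF is_composition_take[OF K(1)], of i s]
      converges_at_take[OF conv', of i] s2 by (cases "i = 0") auto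
  have F1: "F (p - j) = (-1) ^ (p - j) * multi_polylog1 (rev (drop j m)) (1 - t) *
      (\<Sum>\<^sub>\<infinity>n\<in>{1..}. zeta_star n (hoffman_dual (take j m)) / (real n ^ (k + 2) * 4 ^ n) * real ((2 * n) choose n))"
    if j: "j \<in> {1..p}" for j
  proof -
    have l: "length (reverse_incr m) = p" by (simp add: length_reverse_incr m(2) p_def)
    have "drop (p - j) K = reverse_incr (take j m) @ replicate k 1" "take (p - j) K = rev (drop j m)"
      using reverse_incr_drop[of j m] j l by (simp_all add: K_def p_def)
    moreover have "is_composition (take j m)" "take j m \<noteq> []"
      using is_composition_take[OF m(1)] m(2) j by auto
    ultimately show ?thesis
      unfolding F_def li using central_total_eq_infsum_zeta_star[of "take j m" k] by (simp add: mult_ac)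
  qed
  have F2: "F (p + k) = (-1) ^ (p + k) * (2 * ln 2) * multi_polylog1 K (1 - t)"
    unfolding F_def li by (simp add: len central_total_def)
  have F3: "F (p + k - j) = (-1) ^ (p + k - j) * multi_polylog1 (reverse_incr m @ replicate (k - j) 1) (1 - t) *
      (\<Sum>\<^sub>\<infinity>n\<in>{1..}. real ((2 * n) choose n) / (real n ^ (j + 1) * 4 ^ n))" if j: "j \<in> {1..k}" for j
  proof -
    have l: "length (reverse_incr m) = p" by (simp add: length_reverse_incr m(2) p_def)
    have "p + k - j - p = k - j" "p \<le> p + k - j" using j by auto
    then have "drop (p + k - j) K = replicate j 1" "take (p + k - j) K = reverse_incr m @ replicate (k - j) 1"
      using j l by (simp_all add: K_def min_def)
    then show ?thesis
      unfolding F_def li using central_total_replicate[of j] j by (simp add: mult_ac)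
  qed
  have sl: "Suc (sum_list K) = (sum_list m + 2 - p) + (p + k)"
  proof -
    have "length m \<le> sum_list m" using m(1)
      by (induction m) (auto simp: is_composition_def)
    then show ?thesis
      by (simp add: K_def p_def sum_list_reverse_incr[OF m(2)] sum_list_replicate)
  qed
  have "2 ^ (p + k) * (2 ^ (sum_list m + 2 - p) * (\<Sum>\<sigma>\<in>{1..p + k} \<rightarrow>\<^sub>E {1, -1}.
      multi_polylog (K @ [1]) (sign_args (p + k) \<sigma> s))) = 2 ^ (p + k) * powser (li_steps K log_coeff) s"
    using sum_signs_multi_polylog[OF K conv'] unfolding sl len power_add by (simp only: mult_ac)
  then have "powser (li_steps K log_coeff) s = 2 ^ (sum_list m + 2 - p) * (\<Sum>\<sigma>\<in>{1..p + k} \<rightarrow>\<^sub>E {1, -1}.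
      multi_polylog (K @ [1]) (sign_args (p + k) \<sigma> s))" by simp
  moreover have "K @ [1] = reverse_incr m @ replicate (k + 1) 1"
    by (simp add: K_def replicate_append_same)
  ultimately have G: "powser (li_steps K log_coeff) s = 2 ^ (sum_list m + 2 - p) * (\<Sum>\<sigma>\<in>{1..p + k} \<rightarrow>\<^sub>E {1, -1}.
      multi_polylog (reverse_incr m @ replicate (k + 1) 1) (sign_args (p + k) \<sigma> s))"
    by (simp only:)
  have "powser (central_coeff K) t = powser (sqrt_coeff K) s"
    using powser_central_coeff_closed[OF K conv'] s2 by simp
  also have "\<dots> = (\<Sum>i\<le>p + k. F i) + (-1) ^ (p + k) * powser (li_steps K log_coeff) s"
    using powser_sqrt_coeff[OF K(1) conv'] by (simp only: len F_def)
  also have "(\<Sum>i\<le>p + k. F i) = (\<Sum>j=1..p. F (p - j)) + F (p + k) + (\<Sum>j=1..k. F (p + k - j))"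
    by (rule sum_atMost_split_reflect)
  also have "(\<Sum>j=1..p. F (p - j)) = (\<Sum>j=1..p. (-1) ^ (p - j) * multi_polylog1 (rev (drop j m)) (1 - t) *
      (\<Sum>\<^sub>\<infinity>n\<in>{1..}. zeta_star n (hoffman_dual (take j m)) / (real n ^ (k + 2) * 4 ^ n) * real ((2 * n) choose n)))"
    by (rule sum.cong[OF refl F1])
  also have "(\<Sum>j=1..k. F (p + k - j)) = (\<Sum>j=1..k. (-1) ^ (p + k - j) *
      multi_polylog1 (reverse_incr m @ replicate (k - j) 1) (1 - t) *
      (\<Sum>\<^sub>\<infinity>n\<in>{1..}. real ((2 * n) choose n) / (real n ^ (j + 1) * 4 ^ n)))"
    by (rule sum.cong[OF refl F3])
  finally show ?thesis
    unfolding F2 G unfolding sign_args_def s_def K_def by (simp only: mult.assoc)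
qed

theorem theorem2p5:
  fixes k p :: nat and m :: "nat list" and x :: real
  assumes "1 \<le> p" and "length m = p" and "is_composition m" and "0 \<le> x" and "x \<le> 1"
  shows
    "let
       L = (\<lambda>t. \<Sum>\<^sub>\<infinity>n\<in>{1..}. zeta_star_param n (hoffman_dual m) t / (real n ^ (k + 2) * 4 ^ n)
                  * real ((2 * n) choose n));
       R = (\<lambda>t.
         (\<Sum>j=1..p. (-1) ^ (p - j) * multi_polylog1 (rev (drop j m)) (1 - t) *
            (\<Sum>\<^sub>\<infinity>n\<in>{1..}. zeta_star n (hoffman_dual (take j m)) / (real n ^ (k + 2) * 4 ^ n)
                           * real ((2 * n) choose n)))
         + (-1) ^ (p + k) * (2 * ln 2) * multi_polylog1 (reverse_incr m @ replicate k 1) (1 - t)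
         + (\<Sum>j=1..k. (-1) ^ (p + k - j) *
              multi_polylog1 (reverse_incr m @ replicate (k - j) 1) (1 - t) *
              (\<Sum>\<^sub>\<infinity>n\<in>{1..}. real ((2 * n) choose n) / (real n ^ (j + 1) * 4 ^ n)))
         + (-1) ^ (p + k) * 2 ^ (sum_list m + 2 - p) *
            (\<Sum>\<sigma>\<in>{1..p + k} \<rightarrow>\<^sub>E {1, -1}.
               multi_polylog (reverse_incr m @ replicate (k + 1) 1)
                 ((\<sigma> 1 * sqrt (1 - t)) # map (\<lambda>i. \<sigma> i * \<sigma> (i + 1)) [1..<p + k]
                    @ [- \<sigma> (p + k)])))
     in if x = 0 \<and> 2 \<le> p \<and> last m = 1
        then (R \<longlongrightarrow> L x) (at_right x)
        else L x = R x"
proof -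
  define K where "K = reverse_incr m @ replicate k 1"
  have m: "m \<noteq> []" using assms by auto
  have K: "K \<noteq> []" by (simp add: K_def reverse_incr_def)
  define L where "L = (\<lambda>t. \<Sum>\<^sub>\<infinity>n\<in>{1..}. zeta_star_param n (hoffman_dual m) t / (real n ^ (k + 2) * 4 ^ n)
                  * real ((2 * n) choose n))"
  define R where "R = (\<lambda>t.
         (\<Sum>j=1..p. (-1) ^ (p - j) * multi_polylog1 (rev (drop j m)) (1 - t) *
            (\<Sum>\<^sub>\<infinity>n\<in>{1..}. zeta_star n (hoffman_dual (take j m)) / (real n ^ (k + 2) * 4 ^ n)
                           * real ((2 * n) choose n)))
         + (-1) ^ (p + k) * (2 * ln 2) * multi_polylog1 (reverse_incr m @ replicate k 1) (1 - t)
         + (\<Sum>j=1..k. (-1) ^ (p + k - j) *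
              multi_polylog1 (reverse_incr m @ replicate (k - j) 1) (1 - t) *
              (\<Sum>\<^sub>\<infinity>n\<in>{1..}. real ((2 * n) choose n) / (real n ^ (j + 1) * 4 ^ n)))
         + (-1) ^ (p + k) * 2 ^ (sum_list m + 2 - p) *
            (\<Sum>\<sigma>\<in>{1..p + k} \<rightarrow>\<^sub>E {1, -1}.
               multi_polylog (reverse_incr m @ replicate (k + 1) 1)
                 ((\<sigma> 1 * sqrt (1 - t)) # map (\<lambda>i. \<sigma> i * \<sigma> (i + 1)) [1..<p + k]
                    @ [- \<sigma> (p + k)])))"
  have L: "L t = powser (central_coeff K) t" if "0 \<le> t" "t \<le> 1" for t
    unfolding L_def K_def powser_def
    by (rule infsumI) (rule has_sum_zeta_star_dual[OF assms(3) m that])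
  have R: "R t = powser (central_coeff K) t"
    if "0 \<le> t" "t \<le> 1" "converges_at K (sqrt (1 - t))" for t
    using powser_central_coeff_expansion[OF assms(3) m that(1,2), of k] that(3)
    unfolding R_def K_def assms(2) by simp
  have "if x = 0 \<and> 2 \<le> p \<and> last m = 1 then (R \<longlongrightarrow> L x) (at_right x) else L x = R x"
  proof (cases "x = 0 \<and> 2 \<le> p \<and> last m = 1")
    case True
    have "continuous_on {0..1} (powser (central_coeff K))"
      by (rule continuous_on_subset[OF continuous_on_powser_central_coeff[OF K]]) auto
    then have "(powser (central_coeff K) \<longlongrightarrow> powser (central_coeff K) 0) (at_right 0)"
      by (simp add: continuous_on_Icc_at_rightD)
    moreover have "eventually (\<lambda>t. powser (central_coeff K) t = R t) (at_right 0)"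
      using eventually_at_right_real[OF zero_less_one]
      by (rule eventually_mono) (auto simp: R converges_at_def)
    ultimately have "(R \<longlongrightarrow> powser (central_coeff K) 0) (at_right 0)"
      by (rule Lim_transform_eventually)
    then show ?thesis using True L[of 0] by simp
  next
    case False
    have "converges_at K (sqrt (1 - x))"
    proof (cases "x = 0")
      case True
      have "2 \<le> hd K"
      proof (cases "tl m = []")
        case True
        then have "1 \<le> hd m" using assms(3) m by (cases m) (auto simp: is_composition_def)
        then show ?thesis using True by (simp add: K_def reverse_incr_def)
      next
        case tl: False
        have "2 \<le> p" using tl assms(2) by (cases m; cases "tl m") auto
        then have "last m \<noteq> 1" using False True by simp
        moreover have "1 \<le> last m" using assms(3) m by (auto simp: is_composition_def)
        ultimately have "2 \<le> last m" by simp
        then show ?thesis using tl by (simp add: K_def reverse_incr_def hd_rev last_tl)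
      qed
      then show ?thesis using True K by (simp add: converges_at_def)
    qed (use assms in \<open>simp add: converges_at_def\<close>)
    then have "L x = R x" using L[of x] R[of x] assms(4,5) by simp
    then show ?thesis using False by (simp only: if_False)
  qed
  then show ?thesis unfolding Let_def L_def R_def .
qed

end
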